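(* Let $N\le n$ be positive integers tending to infinity along a sequence, with $c_N=N/n$ satisfying $0<\liminf c_N\le\limsup c_N<1$. For each $N$ let $\boldsymbol{\Omega}_1,\dots,\boldsymbol{\Omega}_n$ be $N\times N$ Hermitian positive definite matrices such that $w_{\min}:=\inf_N\min_{1\le i\le n}\lambda_{\min}(\boldsymbol{\Omega}_i)>0$ and $w_{\max}:=\sup_N\max_{1\le i\le n}\lambda_{\max}(\boldsymbol{\Omega}_i)<+\infty$. Let $\mu_N$ be the probability measure defined in the context and $\mathcal{S}_N$ its support. Then $0\notin\mathcal{S}_N$. In particular, there exists $\epsilon>0$ such that $[0,\epsilon]\cap\mathcal{S}_N=\emptyset$.
   Context: For $z\in\mathbb{C}\setminus\mathbb{R}_+$, let $\delta_1(z),\dots,\delta_n(z)$ be the unique solution, among functions that are Stieltjes transforms of nonnegative finite measures carried by $\mathbb{R}_+$, of the system $\delta_i(z)=\frac1n\operatorname{tr}\boldsymbol{\Omega}_i{\bf T}_N(z)$, $i=1,\dots,n$, where ${\bf T}_N(z)=\left(\frac1n\sum_{j=1}^n\frac{\boldsymbol{\Omega}_j}{1+\delta_j(z)}-z{\bf I}_N\right)^{-1}$. The function $m_N(z)=\frac1N\operatorname{tr}{\bf T}_N(z)$ is the Stieltjes transform $\int\frac{d\mu_N(\lambda)}{\lambda-z}$ of a probability measure $\mu_N$ carried by $\mathbb{R}_+$; $\mathcal{S}_N$ denotes the support of $\mu_N$.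
   Formalization: The claims are proved for all sufficiently large N, with ε independent of N, rather than for every N: finitely many terms may have N = n, where 0 can lie in the support (e.g. all Ω_i = I); early terms with N < n follow by passing to copies of Ω_i⊗I_m. *)

theory Defs
  imports "HOL-Probability.Probability" "Jordan_Normal_Form.Gauss_Jordan_Elimination"
    "Jordan_Normal_Form.Char_Poly"
begin

definition mat_trace :: "complex mat \<Rightarrow> complex" where
  "mat_trace A = (\<Sum>i<dim_row A. A $$ (i, i))"

definition hermitian_mat :: "nat \<Rightarrow> complex mat \<Rightarrow> bool" where
  "hermitian_mat N A \<longleftrightarrow> A \<in> carrier_mat N N \<and>
     (\<forall>a<N. \<forall>b<N. A $$ (a, b) = cnj (A $$ (b, a)))"

definition hpd_mat :: "nat \<Rightarrow> complex mat \<Rightarrow> bool" where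
  "hpd_mat N A \<longleftrightarrow> hermitian_mat N A \<and> (\<forall>l. eigenvalue A l \<longrightarrow> 0 < Re l)"

definition inv_mat :: "complex mat \<Rightarrow> complex mat" where
  "inv_mat M = (case mat_inverse M of Some B \<Rightarrow> B | None \<Rightarrow> 0\<^sub>m (dim_row M) (dim_row M))"

definition Rplus :: "complex set" where
  "Rplus = complex_of_real ` {0..}"

definition stieltjes :: "real measure \<Rightarrow> complex \<Rightarrow> complex" where
  "stieltjes \<nu> z = (\<integral>t. 1 / (complex_of_real t - z) \<partial>\<nu>)"

definition finite_meas_Rplus :: "real measure \<Rightarrow> bool" where
  "finite_meas_Rplus \<nu> \<longleftrightarrow> finite_measure \<nu> \<and> sets \<nu> = sets borel \<and> emeasure \<nu> {..<0} = 0"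

definition is_stieltjes_Rplus :: "(complex \<Rightarrow> complex) \<Rightarrow> bool" where
  "is_stieltjes_Rplus f \<longleftrightarrow>
     (\<exists>\<nu>. finite_meas_Rplus \<nu> \<and> (\<forall>z. z \<notin> Rplus \<longrightarrow> f z = stieltjes \<nu> z))"

definition T_mat :: "nat \<Rightarrow> nat \<Rightarrow> (nat \<Rightarrow> complex mat) \<Rightarrow> (nat \<Rightarrow> complex \<Rightarrow> complex)
    \<Rightarrow> complex \<Rightarrow> complex mat" where
  "T_mat N n \<Omega> \<delta> z = inv_mat (mat N N (\<lambda>(a, b).
      (1 / of_nat n) * (\<Sum>j<n. (\<Omega> j $$ (a, b)) / (1 + \<delta> j z))
      - (if a = b then z else 0)))"

definition delta_solution :: "nat \<Rightarrow> nat \<Rightarrow> (nat \<Rightarrow> complex mat) \<Rightarrow> (nat \<Rightarrow> complex \<Rightarrow> complex) \<Rightarrow> bool" where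
  "delta_solution N n \<Omega> \<delta> \<longleftrightarrow>
     (\<forall>i<n. is_stieltjes_Rplus (\<delta> i)) \<and>
     (\<forall>z. z \<notin> Rplus \<longrightarrow> (\<forall>i<n. \<delta> i z = (1 / of_nat n) * mat_trace (\<Omega> i * T_mat N n \<Omega> \<delta> z)))"

definition m_fun :: "nat \<Rightarrow> nat \<Rightarrow> (nat \<Rightarrow> complex mat) \<Rightarrow> (nat \<Rightarrow> complex \<Rightarrow> complex) \<Rightarrow> complex \<Rightarrow> complex" where
  "m_fun N n \<Omega> \<delta> z = (1 / of_nat N) * mat_trace (T_mat N n \<Omega> \<delta> z)"

definition meas_support :: "real measure \<Rightarrow> real set" where
  "meas_support \<mu> = {x. \<forall>e>0. emeasure \<mu> (ball x e) > 0}"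

end

theory Submission
  imports Defs
begin

text \<open>
  Write \<open>S(z) = (1/n) \<Sum>\<^sub>j \<Omega>\<^sub>j / (1 + \<delta>\<^sub>j(z)) - z\<close>, so that \<open>T = S\<inverse>\<close>, and let \<open>x0 < 0\<close>. Then \<open>\<delta>\<^sub>j(x0) \<ge> 0\<close>, and
  taking the trace of \<open>S(x0) T(x0) = I\<close> gives \<open>(1/n) \<Sum>\<^sub>j 1 / (1 + \<delta>\<^sub>j(x0)) \<ge> 1 - N/n\<close>. Hence
  \<open>T(x0)\<close> and the \<open>\<delta>\<^sub>j(x0)\<close> are bounded by constants depending only on the bounds for \<open>\<Omega>\<close> and \<open>N/n\<close>,
  uniformly in \<open>x0\<close>. The linearisation of the system at \<open>x0\<close> has a nonnegative matrix that maps the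
  vector \<open>1 + \<delta>(x0)\<close> below \<open>\<delta>(x0)\<close>, so it is a uniform contraction for the sup norm weighted by
  \<open>1 + \<delta>(x0)\<close>. Comparing \<open>\<delta>(z)\<close> and \<open>\<delta>(z')\<close> through the resolvent identity, and a continuity argument along
  segments issued from \<open>x0\<close>, show that \<open>\<delta>\<close> is Lipschitz on a disc around \<open>x0\<close> slit along the positive
  axis, with radius and Lipschitz constant uniform in \<open>x0\<close>, so that the disc contains \<open>0\<close> once \<open>x0\<close> is
  close to \<open>0\<close>. Comparing the values at \<open>x + iy\<close> and \<open>x - iy\<close> yields \<open>Im m(x + iy) = O(y)\<close>, hence
  \<open>\<mu>(x - y, x + y) = O(y\<^sup>2)\<close> near \<open>0\<close>, and covering an interval by such balls shows that it is a null set.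
\<close>

unbundle no vec_syntax
unbundle no inner_syntax

section \<open>Vectors, operator bounds and positive semidefinite forms\<close>

definition nrm :: "complex vec \<Rightarrow> real" where
  "nrm v = L2_set (\<lambda>i. cmod (v $ i)) {..<dim_vec v}"

lemma nrm_nonneg [simp]: "0 \<le> nrm v"
  by (simp add: nrm_def)

lemma cscalar_prod_eq_sum:
  fixes u v :: "complex vec"
  assumes "u \<in> carrier_vec N" "v \<in> carrier_vec N"
  shows "u \<bullet>c v = (\<Sum>i<N. u $ i * cnj (v $ i))"
  using assms by (auto simp: scalar_prod_def atLeast0LessThan)

lemma cscalar_prod_self:
  assumes "v \<in> carrier_vec N"
  shows "v \<bullet>c v = of_real ((nrm v)\<^sup>2)"
  using assms by (simp add: cscalar_prod_eq_sum[OF assms assms] nrm_def L2_set_def sum_nonneg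
      complex_norm_square del: of_real_power)

lemma Re_cscalar_prod_self:
  assumes "v \<in> carrier_vec N"
  shows "Re (v \<bullet>c v) = (nrm v)\<^sup>2"
  by (simp add: cscalar_prod_self[OF assms] del: of_real_power)

lemma nrm_eq_0_iff:
  assumes "v \<in> carrier_vec N"
  shows "nrm v = 0 \<longleftrightarrow> v = 0\<^sub>v N"
  using assms by (auto simp: nrm_def L2_set_eq_0_iff)

lemma nrm_add:
  assumes "u \<in> carrier_vec N" "v \<in> carrier_vec N"
  shows "nrm (u + v) \<le> nrm u + nrm v"
proof -
  have "nrm (u + v) \<le> L2_set (\<lambda>i. cmod (u $ i) + cmod (v $ i)) {..<N}"
    using assms by (auto simp: nrm_def intro!: L2_set_mono norm_triangle_ineq)
  also have "\<dots> \<le> nrm u + nrm v"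
    using assms L2_set_triangle_ineq[of "\<lambda>i. cmod (u $ i)" "\<lambda>i. cmod (v $ i)" "{..<N}"]
    by (simp add: nrm_def)
  finally show ?thesis .
qed

lemma nrm_smult: "nrm (c \<cdot>\<^sub>v v) = cmod c * nrm v"
proof -
  have "nrm (c \<cdot>\<^sub>v v) = L2_set (\<lambda>i. cmod c * cmod (v $ i)) {..<dim_vec v}"
    by (auto simp: nrm_def norm_mult intro!: L2_set_cong)
  then show ?thesis
    by (simp add: nrm_def L2_set_right_distrib)
qed

lemma cmod_index_le_nrm:
  assumes "i < dim_vec v"
  shows "cmod (v $ i) \<le> nrm v"
  unfolding nrm_def using assms by (intro member_le_L2_set) auto

lemma nrm_unit_vec:
  assumes "i < N"
  shows "nrm (unit_vec N i) = 1"
proof -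
  have "(\<Sum>j<N. (cmod (unit_vec N i $ j))\<^sup>2) = (\<Sum>j<N. if j = i then 1 else 0)"
    by (rule sum.cong) (auto simp: unit_vec_def)
  then show ?thesis
    using assms by (simp add: nrm_def L2_set_def)
qed

lemma cmod_cscalar_prod_le:
  assumes "u \<in> carrier_vec N" "v \<in> carrier_vec N"
  shows "cmod (u \<bullet>c v) \<le> nrm u * nrm v"
proof -
  have "cmod (u \<bullet>c v) \<le> (\<Sum>i<N. \<bar>cmod (u $ i)\<bar> * \<bar>cmod (v $ i)\<bar>)"
    by (auto simp: cscalar_prod_eq_sum[OF assms] norm_mult intro!: order.trans[OF norm_sum])
  also have "\<dots> \<le> nrm u * nrm v"
    using assms L2_set_mult_ineq[of "\<lambda>i. cmod (u $ i)" "\<lambda>i. cmod (v $ i)" "{..<N}"]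
    by (simp add: nrm_def)
  finally show ?thesis .
qed

lemma cscalar_prod_commute:
  fixes u v :: "complex vec"
  assumes "u \<in> carrier_vec N" "v \<in> carrier_vec N"
  shows "u \<bullet>c v = cnj (v \<bullet>c u)"
  by (simp add: cscalar_prod_eq_sum[OF assms] cscalar_prod_eq_sum[OF assms(2,1)] mult.commute)

lemma cscalar_prod_add_left:
  fixes u v x :: "complex vec"
  assumes "u \<in> carrier_vec N" "v \<in> carrier_vec N" "x \<in> carrier_vec N"
  shows "(u + v) \<bullet>c x = u \<bullet>c x + v \<bullet>c x"
  using assms by (simp add: add_scalar_prod_distrib[of _ N])

lemma cscalar_prod_diff_left:
  fixes u v x :: "complex vec"
  assumes "u \<in> carrier_vec N" "v \<in> carrier_vec N" "x \<in> carrier_vec N"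
  shows "(u - v) \<bullet>c x = u \<bullet>c x - v \<bullet>c x"
  using assms by (simp add: minus_scalar_prod_distrib[of _ N])

lemma cscalar_prod_add_right:
  fixes u v x :: "complex vec"
  assumes "u \<in> carrier_vec N" "v \<in> carrier_vec N" "x \<in> carrier_vec N"
  shows "x \<bullet>c (u + v) = x \<bullet>c u + x \<bullet>c v"
  using assms by (simp add: conjugate_add_vec[of _ N] scalar_prod_add_distrib[of _ N])

lemma cscalar_prod_diff_right:
  fixes u v x :: "complex vec"
  assumes "u \<in> carrier_vec N" "v \<in> carrier_vec N" "x \<in> carrier_vec N"
  shows "x \<bullet>c (u - v) = x \<bullet>c u - x \<bullet>c v"
  using assms
  by (simp add: cscalar_prod_eq_sum[of x N "u - v"] cscalar_prod_eq_sum[of x N u]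
      cscalar_prod_eq_sum[of x N v] right_diff_distrib sum_subtractf)

lemma cscalar_prod_smult_left:
  fixes u x :: "complex vec"
  assumes "u \<in> carrier_vec N" "x \<in> carrier_vec N"
  shows "(c \<cdot>\<^sub>v u) \<bullet>c x = c * (u \<bullet>c x)"
  using assms by simp

lemma cscalar_prod_smult_right:
  fixes u x :: "complex vec"
  assumes "u \<in> carrier_vec N" "x \<in> carrier_vec N"
  shows "x \<bullet>c (c \<cdot>\<^sub>v u) = cnj c * (x \<bullet>c u)"
  using assms by (simp add: conjugate_smult_vec)

lemmas cscalar_prod_linear = cscalar_prod_add_left cscalar_prod_diff_left cscalar_prod_add_right cscalar_prod_diff_right
  cscalar_prod_smult_left cscalar_prod_smult_right

lemma cscalar_prod_unit_vec:
  fixes v :: "complex vec"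
  assumes "v \<in> carrier_vec N" "i < N"
  shows "v \<bullet>c unit_vec N i = v $ i"
proof -
  have "v \<bullet>c unit_vec N i = (\<Sum>j<N. if j = i then v $ j else 0)"
    unfolding cscalar_prod_eq_sum[OF assms(1) unit_vec_carrier[of N i]]
    by (rule sum.cong) (use assms in \<open>auto simp: unit_vec_def\<close>)
  then show ?thesis using assms by simp
qed

section \<open>Operator norm bounds\<close>

text \<open>A relation instead of a norm: only upper bounds are propagated, and the dimension
  condition travels with the bound, so no supremum has to be handled.\<close>

definition opnorm_le :: "nat \<Rightarrow> real \<Rightarrow> complex mat \<Rightarrow> bool" where
  "opnorm_le N K A \<longleftrightarrow> A \<in> carrier_mat N N \<and> (\<forall>v\<in>carrier_vec N. nrm (A *\<^sub>v v) \<le> K * nrm v)"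

lemma opnorm_le_carrier: "opnorm_le N K A \<Longrightarrow> A \<in> carrier_mat N N"
  by (simp add: opnorm_le_def)

lemma opbD: "opnorm_le N K A \<Longrightarrow> v \<in> carrier_vec N \<Longrightarrow> nrm (A *\<^sub>v v) \<le> K * nrm v"
  by (simp add: opnorm_le_def)

lemma opnorm_le_mono: "opnorm_le N K A \<Longrightarrow> K \<le> L \<Longrightarrow> opnorm_le N L A"
  unfolding opnorm_le_def by (meson mult_right_mono nrm_nonneg order.trans)

text \<open>Testing on a unit vector; in dimension 0 every \<open>K\<close>, negative ones included,
  would be an admissible bound.\<close>

lemma opnorm_le_nonneg:
  assumes "opnorm_le N K A" "0 < N"
  shows "0 \<le> K"
  using opbD[OF assms(1) unit_vec_carrier[of N 0]] nrm_unit_vec[OF assms(2)] nrm_nonneg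
  by (metis mult.right_neutral order.trans)

lemma opnorm_le_zero: "opnorm_le N 0 (0\<^sub>m N N)"
proof -
  have "0\<^sub>m N N *\<^sub>v v = 0\<^sub>v N" if "v \<in> carrier_vec N" for v :: "complex vec"
    using that by (intro eq_vecI) (auto simp: scalar_prod_def)
  then show ?thesis using nrm_eq_0_iff[of "0\<^sub>v N" N] by (auto simp: opnorm_le_def)
qed

lemma opnorm_le_one: "opnorm_le N 1 (1\<^sub>m N)"
  by (auto simp: opnorm_le_def)

lemma opnorm_le_add: "opnorm_le N K A \<Longrightarrow> opnorm_le N L B \<Longrightarrow> opnorm_le N (K + L) (A + B)"
  unfolding opnorm_le_def
  by (auto simp: add_mult_distrib_mat_vec[of _ N N] algebra_simps
      intro!: order.trans[OF nrm_add[of _ N]] add_mono)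

lemma smult_mat_mult_vec:
  fixes A :: "complex mat"
  assumes "A \<in> carrier_mat n m" "v \<in> carrier_vec m"
  shows "(c \<cdot>\<^sub>m A) *\<^sub>v v = c \<cdot>\<^sub>v (A *\<^sub>v v)"
  using assms by (intro eq_vecI) auto

lemma opnorm_le_smult: "opnorm_le N K A \<Longrightarrow> opnorm_le N (cmod c * K) (c \<cdot>\<^sub>m A)"
  unfolding opnorm_le_def
  by (auto simp: smult_mat_mult_vec nrm_smult mult.assoc intro!: mult_left_mono)

lemma opnorm_le_mult:
  assumes "opnorm_le N K A" "opnorm_le N L B" "0 \<le> K"
  shows "opnorm_le N (K * L) (A * B)"
proof -
  have "nrm ((A * B) *\<^sub>v v) \<le> K * L * nrm v" if v: "v \<in> carrier_vec N" for v
  proof -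
    have "nrm ((A * B) *\<^sub>v v) = nrm (A *\<^sub>v (B *\<^sub>v v))"
      using assms v by (simp add: opnorm_le_def assoc_mult_mat_vec[of A N N B N v])
    also have "\<dots> \<le> K * nrm (B *\<^sub>v v)"
      using assms v by (auto simp: opnorm_le_def)
    also have "\<dots> \<le> K * (L * nrm v)"
      using assms v by (auto simp: opnorm_le_def intro!: mult_left_mono)
    finally show ?thesis by simp
  qed
  then show ?thesis using assms by (auto simp: opnorm_le_def)
qed

lemma opnorm_le_exists:
  assumes A: "A \<in> carrier_mat N N"
  shows "\<exists>K>0. opnorm_le N K A"
proof -
  \<comment> \<open>The summand 1 makes \<open>K\<close> positive, so that it may be divided by. Any
    bound will do, hence the crude sum over all entries.\<close>
  define K where "K = 1 + (\<Sum>i<N. \<Sum>j<N. cmod (A $$ (i, j)))"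
  have "nrm (A *\<^sub>v v) \<le> K * nrm v" if v: "v \<in> carrier_vec N" for v
  proof -
    have "nrm (A *\<^sub>v v) \<le> (\<Sum>i<N. cmod ((A *\<^sub>v v) $ i))"
      unfolding nrm_def using A L2_set_le_sum[of "{..<N}" "\<lambda>i. cmod ((A *\<^sub>v v) $ i)"] by simp
    also have "\<dots> \<le> (\<Sum>i<N. \<Sum>j<N. cmod (A $$ (i, j)) * nrm v)"
    proof (rule sum_mono)
      fix i assume i: "i \<in> {..<N}"
      have "cmod ((A *\<^sub>v v) $ i) = cmod (\<Sum>j<N. A $$ (i, j) * v $ j)"
        using A v i by (auto simp: scalar_prod_def atLeast0LessThan)
      also have "\<dots> \<le> (\<Sum>j<N. cmod (A $$ (i, j)) * cmod (v $ j))"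
        by (auto simp: norm_mult intro!: order.trans[OF norm_sum])
      also have "\<dots> \<le> (\<Sum>j<N. cmod (A $$ (i, j)) * nrm v)"
        using v by (intro sum_mono mult_left_mono cmod_index_le_nrm) auto
      finally show "cmod ((A *\<^sub>v v) $ i) \<le> (\<Sum>j<N. cmod (A $$ (i, j)) * nrm v)" .
    qed
    also have "\<dots> \<le> K * nrm v"
      by (simp add: K_def sum_distrib_right[symmetric] mult_right_mono)
    finally show ?thesis .
  qed
  moreover have "0 < K"
    unfolding K_def by (intro add_pos_nonneg sum_nonneg) auto
  ultimately show ?thesis using A by (auto simp: opnorm_le_def)
qed

text \<open>Each diagonal entry is a coordinate of the image of a unit vector, hence at most
  \<open>K\<close> in modulus.\<close>

lemma cmod_mat_trace_le:
  assumes "opnorm_le N K A"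
  shows "cmod (mat_trace A) \<le> real N * K"
proof -
  have A: "A \<in> carrier_mat N N" using assms by (rule opnorm_le_carrier)
  have "cmod (A $$ (i, i)) \<le> K" if i: "i < N" for i
  proof -
    have "A $$ (i, i) = (A *\<^sub>v unit_vec N i) $ i"
      using A i by simp
    then have "cmod (A $$ (i, i)) \<le> nrm (A *\<^sub>v unit_vec N i)"
      using cmod_index_le_nrm[of i "A *\<^sub>v unit_vec N i"] A i by simp
    also have "\<dots> \<le> K"
      using opbD[OF assms, of "unit_vec N i"] nrm_unit_vec[OF i] by simp
    finally show ?thesis .
  qed
  then have "(\<Sum>i<N. cmod (A $$ (i, i))) \<le> (\<Sum>i<N. K)"
    by (intro sum_mono) auto
  then have "cmod (mat_trace A) \<le> (\<Sum>i<N. K)"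
    unfolding mat_trace_def using A by (auto intro!: order.trans[OF norm_sum])
  then show ?thesis by simp
qed

section \<open>Self-adjoint and positive semidefinite matrices\<close>

text \<open>Stated through the sesquilinear form and not through entries, so that it passes to
  shifts, inverses and congruences without entry computations.\<close>

definition selfadj :: "nat \<Rightarrow> complex mat \<Rightarrow> bool" where
  "selfadj N A \<longleftrightarrow> A \<in> carrier_mat N N \<and>
     (\<forall>u\<in>carrier_vec N. \<forall>v\<in>carrier_vec N. (A *\<^sub>v u) \<bullet>c v = u \<bullet>c (A *\<^sub>v v))"

definition psd :: "nat \<Rightarrow> complex mat \<Rightarrow> bool" where
  "psd N A \<longleftrightarrow> selfadj N A \<and> (\<forall>v\<in>carrier_vec N. 0 \<le> Re ((A *\<^sub>v v) \<bullet>c v))"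

lemma selfadj_carrier: "selfadj N A \<Longrightarrow> A \<in> carrier_mat N N"
  by (simp add: selfadj_def)

lemma selfadjD:
  "selfadj N A \<Longrightarrow> u \<in> carrier_vec N \<Longrightarrow> v \<in> carrier_vec N \<Longrightarrow> (A *\<^sub>v u) \<bullet>c v = u \<bullet>c (A *\<^sub>v v)"
  by (simp add: selfadj_def)

lemma psd_selfadj: "psd N A \<Longrightarrow> selfadj N A"
  by (simp add: psd_def)

lemma psd_nonneg: "psd N A \<Longrightarrow> v \<in> carrier_vec N \<Longrightarrow> 0 \<le> Re ((A *\<^sub>v v) \<bullet>c v)"
  by (simp add: psd_def)

lemma mat_entry_eq_cscalar_prod:
  fixes A :: "complex mat"
  assumes "A \<in> carrier_mat N N" "a < N" "b < N"
  shows "A $$ (a, b) = (A *\<^sub>v unit_vec N b) \<bullet>c unit_vec N a"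
  using assms by (subst cscalar_prod_unit_vec[of _ N]) auto

lemma selfadj_entry:
  assumes "selfadj N A" "a < N" "b < N"
  shows "A $$ (a, b) = cnj (A $$ (b, a))"
proof -
  have A: "A \<in> carrier_mat N N" using assms by (simp add: selfadj_def)
  have "A $$ (a, b) = unit_vec N b \<bullet>c (A *\<^sub>v unit_vec N a)"
    using selfadjD[OF assms(1), of "unit_vec N b" "unit_vec N a"] assms(2,3)
      mat_entry_eq_cscalar_prod[OF A assms(2,3)] by simp
  also have "\<dots> = cnj (A $$ (b, a))"
    using mat_entry_eq_cscalar_prod[OF A assms(3,2)]
      cscalar_prod_commute[of "unit_vec N b" N "A *\<^sub>v unit_vec N a"] A by simp
  finally show ?thesis .
qed

lemma hermitian_imp_selfadj:
  assumes "hermitian_mat N A"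
  shows "selfadj N A"
proof -
  have A: "A \<in> carrier_mat N N" and h: "\<And>a b. a < N \<Longrightarrow> b < N \<Longrightarrow> A $$ (a, b) = cnj (A $$ (b, a))"
    using assms unfolding hermitian_mat_def by blast+
  have "(A *\<^sub>v u) \<bullet>c v = u \<bullet>c (A *\<^sub>v v)" if u: "u \<in> carrier_vec N" and v: "v \<in> carrier_vec N" for u v
  proof -
    have "(A *\<^sub>v u) \<bullet>c v = (\<Sum>i<N. \<Sum>j<N. A $$ (i, j) * u $ j * cnj (v $ i))"
      using A u v
      by (subst cscalar_prod_eq_sum[of _ N])
        (auto simp: scalar_prod_def atLeast0LessThan sum_distrib_right)
    also have "\<dots> = (\<Sum>j<N. \<Sum>i<N. A $$ (i, j) * u $ j * cnj (v $ i))"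
      by (rule sum.swap)
    also have "\<dots> = (\<Sum>j<N. \<Sum>i<N. u $ j * cnj (A $$ (j, i) * v $ i))"
    proof (intro sum.cong refl)
      fix i j assume "i \<in> {..<N}" "j \<in> {..<N}"
      then have "A $$ (i, j) = cnj (A $$ (j, i))" by (intro h) auto
      then show "A $$ (i, j) * u $ j * cnj (v $ i) = u $ j * cnj (A $$ (j, i) * v $ i)"
        by simp
    qed
    also have "\<dots> = u \<bullet>c (A *\<^sub>v v)"
      using A u v
      by (subst cscalar_prod_eq_sum[of _ N])
        (auto simp: scalar_prod_def atLeast0LessThan sum_distrib_left)
    finally show ?thesis .
  qed
  then show ?thesis using A by (auto simp: selfadj_def)
qed

lemma selfadj_Im:
  assumes "selfadj N A" "v \<in> carrier_vec N"
  shows "Im ((A *\<^sub>v v) \<bullet>c v) = 0"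
proof -
  have "A *\<^sub>v v \<in> carrier_vec N" using assms by (auto simp: selfadj_def)
  then have "(A *\<^sub>v v) \<bullet>c v = cnj ((A *\<^sub>v v) \<bullet>c v)"
    using selfadjD[OF assms(1,2,2)] cscalar_prod_commute assms(2) by metis
  from arg_cong[OF this, of Im] show ?thesis by simp
qed

text \<open>The discriminant argument: the form is nonnegative at \<open>u + s b v\<close> for every
  real \<open>s\<close>, where the factor \<open>b\<close> aligns the phase of the cross term. The
  form may be degenerate, so \<open>c = 0\<close> is a separate case.\<close>

lemma psd_Cauchy_Schwarz:
  assumes P: "psd N A" and u: "u \<in> carrier_vec N" and v: "v \<in> carrier_vec N"
  shows "(cmod ((A *\<^sub>v u) \<bullet>c v))\<^sup>2 \<le> Re ((A *\<^sub>v u) \<bullet>c u) * Re ((A *\<^sub>v v) \<bullet>c v)"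
proof -
  have sa: "selfadj N A" and A: "A \<in> carrier_mat N N"
    using P by (auto simp: psd_def selfadj_def)
  define a b c where "a = Re ((A *\<^sub>v u) \<bullet>c u)" and "b = (A *\<^sub>v u) \<bullet>c v" and "c = Re ((A *\<^sub>v v) \<bullet>c v)"
  have ac: "0 \<le> a" "0 \<le> c" using P u v by (auto simp: a_def c_def psd_def)
  have b': "(A *\<^sub>v v) \<bullet>c u = cnj b"
    using selfadjD[OF sa v u] cscalar_prod_commute[of v N "A *\<^sub>v u"] A u v by (simp add: b_def)
  have quad: "0 \<le> a + 2 * s * (cmod b)\<^sup>2 + s\<^sup>2 * (cmod b)\<^sup>2 * c" for s :: real
  proof -
    define t where "t = of_real s * b"
    have Av: "A *\<^sub>v u \<in> carrier_vec N" "A *\<^sub>v v \<in> carrier_vec N" using A u v by auto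
    have eq: "(A *\<^sub>v (u + t \<cdot>\<^sub>v v)) \<bullet>c (u + t \<cdot>\<^sub>v v)
        = (A *\<^sub>v u) \<bullet>c u + cnj t * b + t * cnj b + t * cnj t * ((A *\<^sub>v v) \<bullet>c v)"
      using A u v Av
      by (simp add: mult_add_distrib_mat_vec[of _ N N] mult_mat_vec[of _ N N]
          cscalar_prod_linear[where N = N] b' b_def[symmetric] algebra_simps)
    have "0 \<le> Re ((A *\<^sub>v u) \<bullet>c u + cnj t * b + t * cnj b + t * cnj t * ((A *\<^sub>v v) \<bullet>c v))"
      unfolding eq[symmetric] using P u v by (auto simp: psd_def)
    also have "\<dots> = a + 2 * s * (cmod b)\<^sup>2 + s\<^sup>2 * (cmod b)\<^sup>2 * c"
      unfolding a_def c_def t_def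
      by (simp add: cmod_power2) (simp add: power2_eq_square algebra_simps)
    finally show ?thesis .
  qed
  show ?thesis
  proof (cases "c = 0")
    case True
    have "b = 0"
    proof (rule ccontr)
      assume "b \<noteq> 0"
      \<comment> \<open>With \<open>c = 0\<close> the expression is affine in \<open>s\<close>, and
        this choice gives it the value -1.\<close>
      then show False using quad[of "- (a + 1) / (2 * (cmod b)\<^sup>2)"] True by (simp add: field_simps)
    qed
    then show ?thesis using ac unfolding a_def b_def c_def by simp
  next
    case False
    then have c: "0 < c" using ac by simp
    \<comment> \<open>The choice \<open>s = - 1 / c\<close> minimises the quadratic
      expression.\<close>
    have "0 \<le> a - (cmod b)\<^sup>2 / c"
      using quad[of "- 1 / c"] c by (simp add: field_simps power2_eq_square)
    then show ?thesis using c unfolding a_def[symmetric] b_def[symmetric] c_def[symmetric]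
      by (simp add: field_simps)
  qed
qed

text \<open>In operator terms, \<open>A^2 \<le> K A\<close>. It is Cauchy-Schwarz for the form of
  \<open>A\<close> with \<open>A v\<close> as second vector, after cancelling the squared norm of
  \<open>A v\<close>.\<close>

lemma psd_nrm_sq_le:
  assumes P: "psd N A" and K: "\<And>v. v \<in> carrier_vec N \<Longrightarrow> Re ((A *\<^sub>v v) \<bullet>c v) \<le> K * (nrm v)\<^sup>2"
    and v: "v \<in> carrier_vec N"
  shows "(nrm (A *\<^sub>v v))\<^sup>2 \<le> K * Re ((A *\<^sub>v v) \<bullet>c v)"
proof -
  have A: "A \<in> carrier_mat N N" using P by (auto simp: psd_def selfadj_def)
  define u where "u = A *\<^sub>v v"
  have u: "u \<in> carrier_vec N" using A v by (simp add: u_def)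
  have "((nrm u)\<^sup>2)\<^sup>2 = (cmod ((A *\<^sub>v v) \<bullet>c u))\<^sup>2"
    by (simp add: u_def[symmetric] cscalar_prod_self[OF u] del: of_real_power)
  also have "\<dots> \<le> Re ((A *\<^sub>v v) \<bullet>c v) * (K * (nrm u)\<^sup>2)"
    by (rule order.trans[OF psd_Cauchy_Schwarz[OF P v u]])
      (intro mult_left_mono K u psd_nonneg[OF P v])
  finally have *: "(nrm u)\<^sup>2 * (nrm u)\<^sup>2 \<le> K * Re ((A *\<^sub>v v) \<bullet>c v) * (nrm u)\<^sup>2"
    by (simp add: power2_eq_square algebra_simps)
  show ?thesis
  proof (cases "nrm u = 0")
    case True
    \<comment> \<open>No sign of \<open>K\<close> is assumed; for nonzero \<open>v\<close> it
      follows from the form bound at \<open>v\<close> itself.\<close>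
    have "0 \<le> K * Re ((A *\<^sub>v v) \<bullet>c v)"
    proof (cases "nrm v = 0")
      case True
      then have "v = 0\<^sub>v N" using nrm_eq_0_iff[OF v] by simp
      then show ?thesis using A by simp
    next
      case False
      have "0 \<le> K * (nrm v)\<^sup>2" using K[OF v] psd_nonneg[OF P v] by linarith
      then have "0 \<le> K" using False by (simp add: zero_le_mult_iff)
      then show ?thesis using psd_nonneg[OF P v] by simp
    qed
    then show ?thesis using True by (simp add: u_def)
  next
    case False
    then have "0 < (nrm u)\<^sup>2" by simp
    from mult_right_le_imp_le[OF * this] show ?thesis by (simp add: u_def)
  qed
qed

text \<open>Since \<open>inv_mat\<close> returns the zero matrix on singular arguments, a nonzero
  determinant has to be secured before \<open>inv_mat\<close> can be treated as an inverse.\<close>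

lemma det_nonzero_inverse:
  fixes A :: "complex mat"
  assumes A: "A \<in> carrier_mat N N" and d: "det A \<noteq> 0"
  shows "inv_mat A \<in> carrier_mat N N" "A * inv_mat A = 1\<^sub>m N" "inv_mat A * A = 1\<^sub>m N"
proof -
  obtain B where B: "mat_inverse A = Some B"
    using mat_inverse(1)[OF A, of "()"] det_non_zero_imp_unit[OF A d, of "()"]
    by (cases "mat_inverse A") auto
  then have "inv_mat A = B" by (simp add: inv_mat_def)
  then show "inv_mat A \<in> carrier_mat N N" "A * inv_mat A = 1\<^sub>m N" "inv_mat A * A = 1\<^sub>m N"
    using mat_inverse(2)[OF A B] by auto
qed

text \<open>The infimum of the Rayleigh quotient is an eigenvalue: otherwise \<open>A\<close> minus the infimum
  would be invertible and hence, by Cauchy--Schwarz for the positive semidefinite form, bounded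
  below. This needs no compactness of the unit sphere.\<close>

lemma eigenvalues_bound_form_below:
  assumes sa: "selfadj N A" and N: "0 < N" and ev: "\<And>l. eigenvalue A l \<Longrightarrow> w \<le> Re l"
    and v: "v \<in> carrier_vec N"
  shows "w * (nrm v)\<^sup>2 \<le> Re ((A *\<^sub>v v) \<bullet>c v)"
proof -
  have A: "A \<in> carrier_mat N N" using sa by (simp add: selfadj_def)
  define L where "L = {l. \<forall>v\<in>carrier_vec N. l * (nrm v)\<^sup>2 \<le> Re ((A *\<^sub>v v) \<bullet>c v)}"
  obtain K where K: "0 < K" "opnorm_le N K A" using opnorm_le_exists[OF A] by auto
  have abs: "\<bar>Re ((A *\<^sub>v v) \<bullet>c v)\<bar> \<le> K * (nrm v)\<^sup>2" if v: "v \<in> carrier_vec N" for v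
  proof -
    have "\<bar>Re ((A *\<^sub>v v) \<bullet>c v)\<bar> \<le> nrm (A *\<^sub>v v) * nrm v"
      using cmod_cscalar_prod_le[of "A *\<^sub>v v" N v] A v abs_Re_le_cmod order.trans by fastforce
    also have "\<dots> \<le> K * nrm v * nrm v"
      by (intro mult_right_mono opbD[OF K(2) v]) auto
    finally show ?thesis by (simp add: power2_eq_square algebra_simps)
  qed
  have ne: "- K \<in> L"
  proof -
    have "- K * (nrm v)\<^sup>2 \<le> Re ((A *\<^sub>v v) \<bullet>c v)" if v: "v \<in> carrier_vec N" for v
      using abs[OF v] by linarith
    then show ?thesis unfolding L_def by blast
  qed
  have le: "l \<le> K" if "l \<in> L" for l
  proof -
    have "l * (nrm (unit_vec N 0))\<^sup>2 \<le> Re ((A *\<^sub>v unit_vec N 0) \<bullet>c unit_vec N 0)"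
      using that unit_vec_carrier[of N 0] unfolding L_def by blast
    then show ?thesis
      using abs[OF unit_vec_carrier[of N 0]] nrm_unit_vec[OF N] by simp
  qed
  then have bdd: "bdd_above L" by (auto simp: bdd_above_def)
  \<comment> \<open>\<open>L\<close> collects the lower bounds of the Rayleigh quotient, so
    \<open>s\<close> is the infimum of that quotient and is again a lower bound.\<close>
  define s where "s = Sup L"
  have sL: "s * (nrm v)\<^sup>2 \<le> Re ((A *\<^sub>v v) \<bullet>c v)" if v: "v \<in> carrier_vec N" for v
  proof (cases "nrm v = 0")
    case True
    then have "v = 0\<^sub>v N" using nrm_eq_0_iff[OF v] by simp
    then show ?thesis using True A by simp
  next
    case False
    then have p: "0 < (nrm v)\<^sup>2" by simp
    have "s \<le> Re ((A *\<^sub>v v) \<bullet>c v) / (nrm v)\<^sup>2"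
      unfolding s_def
    proof (rule cSup_least)
      show "L \<noteq> {}" using ne by auto
      fix l assume "l \<in> L"
      then show "l \<le> Re ((A *\<^sub>v v) \<bullet>c v) / (nrm v)\<^sup>2"
        using p v by (simp add: L_def field_simps)
    qed
    then show ?thesis using p by (simp add: field_simps)
  qed
  define B where "B = A - of_real s \<cdot>\<^sub>m 1\<^sub>m N"
  have B: "B \<in> carrier_mat N N" unfolding B_def by (intro minus_carrier_mat) auto
  have Bv: "B *\<^sub>v v = A *\<^sub>v v - of_real s \<cdot>\<^sub>v v" if "v \<in> carrier_vec N" for v
    using A that unfolding B_def
    by (subst minus_mult_distrib_mat_vec[of _ N N]) (auto simp: smult_mat_mult_vec)
  have Bf: "Re ((B *\<^sub>v v) \<bullet>c v) = Re ((A *\<^sub>v v) \<bullet>c v) - s * (nrm v)\<^sup>2" if v: "v \<in> carrier_vec N" for v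
    using A v by (simp add: Bv cscalar_prod_linear[where N = N] cscalar_prod_self[OF v] del: of_real_power)
  have Bsa: "selfadj N B"
    unfolding selfadj_def
  proof (intro conjI ballI B)
    fix x y :: "complex vec" assume x: "x \<in> carrier_vec N" and y: "y \<in> carrier_vec N"
    have "x \<bullet>c (A *\<^sub>v y - of_real s \<cdot>\<^sub>v y) = x \<bullet>c (A *\<^sub>v y) - of_real s * (x \<bullet>c y)"
      using A x y by (simp add: cscalar_prod_linear[where N = N])
    then show "(B *\<^sub>v x) \<bullet>c y = x \<bullet>c (B *\<^sub>v y)"
      using A x y selfadjD[OF sa x y] by (simp add: Bv cscalar_prod_linear[where N = N])
  qed
  have Bpsd: "psd N B" using Bsa sL Bf by (auto simp: psd_def)
  have "det B = 0"
  proof (rule ccontr)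
    assume d: "det B \<noteq> 0"
    obtain M where M: "0 < M" "opnorm_le N M (inv_mat B)"
      using opnorm_le_exists[OF det_nonzero_inverse(1)[OF B d]] by auto
    have up: "Re ((B *\<^sub>v v) \<bullet>c v) \<le> (K + \<bar>s\<bar>) * (nrm v)\<^sup>2" if "v \<in> carrier_vec N" for v
    proof -
      have "- s * (nrm v)\<^sup>2 \<le> \<bar>s\<bar> * (nrm v)\<^sup>2" by (intro mult_right_mono) auto
      then show ?thesis using Bf[OF that] abs[OF that] by (simp add: algebra_simps)
    qed
    have K': "0 < K + \<bar>s\<bar>" using K by linarith
    \<comment> \<open>Combining \<open>nrm v \<le> M * nrm (B v)\<close> with
      \<open>B^2 \<le> (K + \<bar>s\<bar>) B\<close> shows that the form of \<open>B\<close> is at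
      least \<open>e\<close> times the squared norm. Then \<open>s + e\<close> would be a lower
      bound above the supremum.\<close>
    define e where "e = 1 / (M\<^sup>2 * (K + \<bar>s\<bar>))"
    have e: "0 < e" using M K' by (simp add: e_def)
    have "s + e \<in> L"
      unfolding L_def mem_Collect_eq
    proof
      fix v :: "complex vec" assume v: "v \<in> carrier_vec N"
      have "v = inv_mat B *\<^sub>v (B *\<^sub>v v)"
        using det_nonzero_inverse[OF B d] B v
        by (metis assoc_mult_mat_vec one_mult_mat_vec)
      then have "nrm v \<le> M * nrm (B *\<^sub>v v)"
        using opbD[OF M(2), of "B *\<^sub>v v"] B v by simp
      then have "(nrm v)\<^sup>2 \<le> (M * nrm (B *\<^sub>v v))\<^sup>2" by (intro power_mono) auto
      also have "\<dots> \<le> M\<^sup>2 * ((K + \<bar>s\<bar>) * Re ((B *\<^sub>v v) \<bullet>c v))"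
        using psd_nrm_sq_le[OF Bpsd up v] by (auto simp: power_mult_distrib intro!: mult_left_mono)
      finally have "e * (nrm v)\<^sup>2 \<le> Re ((B *\<^sub>v v) \<bullet>c v)"
        using M K' by (simp add: e_def divide_le_eq mult.commute mult.left_commute)
      then show "(s + e) * (nrm v)\<^sup>2 \<le> Re ((A *\<^sub>v v) \<bullet>c v)"
        using Bf[OF v] by (simp add: algebra_simps)
    qed
    then have "s + e \<le> s" unfolding s_def by (rule cSup_upper[OF _ bdd])
    then show False using e by simp
  qed
  then obtain x where x: "x \<in> carrier_vec N" "x \<noteq> 0\<^sub>v N" "B *\<^sub>v x = 0\<^sub>v N"
    using det_0_iff_vec_prod_zero[OF B] by auto
  have "A *\<^sub>v x = of_real s \<cdot>\<^sub>v x"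
  proof (rule eq_vecI)
    fix i assume i: "i < dim_vec (of_real s \<cdot>\<^sub>v x)"
    have "(A *\<^sub>v x - of_real s \<cdot>\<^sub>v x) $ i = 0"
      using x i Bv[OF x(1)] by simp
    then show "(A *\<^sub>v x) $ i = (of_real s \<cdot>\<^sub>v x) $ i"
      using A x i by simp
  qed (use A x in auto)
  then have "eigenvalue A (of_real s)"
    using x A by (auto simp: eigenvalue_def eigenvector_def)
  then have "w \<le> s" using ev by fastforce
  then have "w * (nrm v)\<^sup>2 \<le> s * (nrm v)\<^sup>2" by (intro mult_right_mono) auto
  then show ?thesis using sL[OF v] by linarith
qed

text \<open>The lower bound applied to \<open>- A\<close>, whose eigenvalues are the negatives of
  those of \<open>A\<close>.\<close>

lemma eigenvalues_bound_form_above: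
  assumes sa: "selfadj N A" and N: "0 < N" and ev: "\<And>l. eigenvalue A l \<Longrightarrow> Re l \<le> w"
    and v: "v \<in> carrier_vec N"
  shows "Re ((A *\<^sub>v v) \<bullet>c v) \<le> w * (nrm v)\<^sup>2"
proof -
  have A: "A \<in> carrier_mat N N" using sa by (simp add: selfadj_def)
  have neg: "(- A) *\<^sub>v u = (- 1) \<cdot>\<^sub>v (A *\<^sub>v u)" if "u \<in> carrier_vec N" for u
    using A that by (intro eq_vecI) (auto simp: scalar_prod_uminus_left)
  have "selfadj N (- A)"
    unfolding selfadj_def
  proof (intro conjI ballI)
    fix x y :: "complex vec" assume x: "x \<in> carrier_vec N" and y: "y \<in> carrier_vec N"
    then have "A *\<^sub>v x \<in> carrier_vec N" "A *\<^sub>v y \<in> carrier_vec N" using A by auto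
    then show "(- A *\<^sub>v x) \<bullet>c y = x \<bullet>c (- A *\<^sub>v y)"
      unfolding neg[OF x] neg[OF y]
      using selfadjD[OF sa x y] cscalar_prod_smult_left[of _ N y "-1"] cscalar_prod_smult_right[of _ N x "-1"] x y
      by (metis complex_cnj_minus complex_cnj_one)
  qed (use A in auto)
  moreover have "- w \<le> Re l" if l: "eigenvalue (- A) l" for l
  proof -
    obtain x where x: "x \<in> carrier_vec N" "x \<noteq> 0\<^sub>v N" "(- A) *\<^sub>v x = l \<cdot>\<^sub>v x"
      using l A by (auto simp: eigenvalue_def eigenvector_def simp del: uminus_mult_mat_vec)
    have "A *\<^sub>v x = (- 1) \<cdot>\<^sub>v ((- A) *\<^sub>v x)" using A x(1)
      by (simp del: uminus_mult_mat_vec add: neg smult_smult_assoc)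
    then have "A *\<^sub>v x = (- l) \<cdot>\<^sub>v x" by (simp add: x(3) smult_smult_assoc)
    then have "eigenvalue A (- l)"
      using x A by (auto simp: eigenvalue_def eigenvector_def)
    then show ?thesis using ev by fastforce
  qed
  ultimately have "- w * (nrm v)\<^sup>2 \<le> Re (((- A) *\<^sub>v v) \<bullet>c v)"
    using N v by (intro eigenvalues_bound_form_below)
  then show ?thesis using A v by (simp add: neg cscalar_prod_linear[where N = N])
qed

text \<open>From \<open>psd_nrm_sq_le\<close>, by using the form bound a second time on the
  right-hand side and taking square roots.\<close>

lemma opnorm_le_of_form_bound:
  assumes P: "psd N A" and K: "\<And>v. v \<in> carrier_vec N \<Longrightarrow> Re ((A *\<^sub>v v) \<bullet>c v) \<le> K * (nrm v)\<^sup>2"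
    and "0 \<le> K"
  shows "opnorm_le N K A"
proof -
  have "nrm (A *\<^sub>v v) \<le> K * nrm v" if v: "v \<in> carrier_vec N" for v
  proof -
    have "(nrm (A *\<^sub>v v))\<^sup>2 \<le> K * (K * (nrm v)\<^sup>2)"
      using psd_nrm_sq_le[OF P K v] mult_left_mono[OF K[OF v] \<open>0 \<le> K\<close>] by simp
    then have "(nrm (A *\<^sub>v v))\<^sup>2 \<le> (K * nrm v)\<^sup>2" by (simp add: power2_eq_square algebra_simps)
    then show ?thesis by (rule power2_le_imp_le) (use \<open>0 \<le> K\<close> in simp)
  qed
  then show ?thesis using P by (auto simp: opnorm_le_def psd_def selfadj_def)
qed

section \<open>Traces of products and perturbation of inverses\<close>

lemma mat_trace_mult:
  assumes "A \<in> carrier_mat N N" "B \<in> carrier_mat N N"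
  shows "mat_trace (A * B) = (\<Sum>i<N. \<Sum>j<N. A $$ (i, j) * B $$ (j, i))"
  using assms by (auto simp: mat_trace_def scalar_prod_def atLeast0LessThan)

lemma mat_trace_add:
  assumes "A \<in> carrier_mat N N" "B \<in> carrier_mat N N"
  shows "mat_trace (A + B) = mat_trace A + mat_trace B"
  using assms by (simp add: mat_trace_def sum.distrib)

lemma mat_trace_diff:
  assumes "A \<in> carrier_mat N N" "B \<in> carrier_mat N N"
  shows "mat_trace (A - B) = mat_trace A - mat_trace B"
  using assms by (simp add: mat_trace_def sum_subtractf)

lemma mat_trace_smult:
  assumes "A \<in> carrier_mat N N"
  shows "mat_trace (c \<cdot>\<^sub>m A) = c * mat_trace A"
  using assms by (simp add: mat_trace_def sum_distrib_left)

lemma mat_trace_one: "mat_trace (1\<^sub>m N) = of_nat N"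
  by (simp add: mat_trace_def)

lemma mat_trace_zero: "mat_trace (0\<^sub>m N N) = 0"
  by (simp add: mat_trace_def)

text \<open>One step of Cholesky elimination: the pivot column \<open>p\<close> is removed by
  subtracting the rank-one matrix \<open>p p^* / P_mm\<close>. Nonnegativity of the rest is exactly
  Cauchy-Schwarz for the form of \<open>P\<close> between \<open>v\<close> and the pivot unit
  vector.\<close>

lemma psd_pivot_step:
  assumes P: "psd N P" and m: "m < N" and pm: "Re (P $$ (m, m)) > 0"
  defines "P' \<equiv> mat N N (\<lambda>(a, b). P $$ (a, b) - P $$ (a, m) * cnj (P $$ (b, m)) / P $$ (m, m))"
  shows "psd N P'"
proof -
  have sa: "selfadj N P" and C: "P \<in> carrier_mat N N"
    using P by (auto simp: psd_def selfadj_def)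
  define r where "r = Re (P $$ (m, m))"
  define p where "p = P *\<^sub>v unit_vec N m"
  have pc: "p \<in> carrier_vec N" using C by (simp add: p_def)
  have r: "P $$ (m, m) = of_real r" "0 < r"
    using pm selfadj_Im[OF sa unit_vec_carrier[of N m]] mat_entry_eq_cscalar_prod[OF C m m]
    by (auto simp: r_def complex_eq_iff)
  have C': "P' \<in> carrier_mat N N" by (simp add: P'_def)
  have form: "(P' *\<^sub>v u) \<bullet>c v = (P *\<^sub>v u) \<bullet>c v - (u \<bullet>c p) * (p \<bullet>c v) / of_real r"
    if u: "u \<in> carrier_vec N" and v: "v \<in> carrier_vec N" for u v
  proof -
    have pi: "p $ i = P $$ (i, m)" if "i < N" for i
      using that C m by (simp add: p_def)
    have "P' *\<^sub>v u = P *\<^sub>v u - ((u \<bullet>c p) / of_real r) \<cdot>\<^sub>v p"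
    proof (rule eq_vecI)
      fix i assume "i < dim_vec (P *\<^sub>v u - ((u \<bullet>c p) / of_real r) \<cdot>\<^sub>v p)"
      then have i: "i < N" using pc by simp
      have "(P' *\<^sub>v u) $ i = (\<Sum>j<N. (P $$ (i, j) - P $$ (i, m) * cnj (P $$ (j, m)) / of_real r) * u $ j)"
        using i u by (simp add: P'_def r scalar_prod_def atLeast0LessThan)
      also have "\<dots> = (\<Sum>j<N. P $$ (i, j) * u $ j)
          - (\<Sum>j<N. u $ j * cnj (P $$ (j, m))) / of_real r * P $$ (i, m)"
        by (simp add: left_diff_distrib sum_subtractf sum_distrib_left sum_distrib_right
            sum_divide_distrib right_diff_distrib mult_ac)
      also have "(\<Sum>j<N. u $ j * cnj (P $$ (j, m))) = u \<bullet>c p"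
        by (simp add: cscalar_prod_eq_sum[OF u pc] pi)
      also have "(\<Sum>j<N. P $$ (i, j) * u $ j) = (P *\<^sub>v u) $ i"
        using i u C by (simp add: scalar_prod_def atLeast0LessThan)
      finally show "(P' *\<^sub>v u) $ i = (P *\<^sub>v u - ((u \<bullet>c p) / of_real r) \<cdot>\<^sub>v p) $ i"
        using i pc C by (simp add: pi)
    qed (use pc C' in auto)
    then show ?thesis
      using C u v pc by (simp add: cscalar_prod_linear[where N = N])
  qed
  have "selfadj N P'"
    unfolding selfadj_def
  proof (intro conjI ballI C')
    fix u v :: "complex vec" assume u: "u \<in> carrier_vec N" and v: "v \<in> carrier_vec N"
    have "u \<bullet>c (P' *\<^sub>v v) = cnj ((P' *\<^sub>v v) \<bullet>c u)"
      using C' u v by (intro cscalar_prod_commute) auto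
    also have "\<dots> = cnj ((P *\<^sub>v v) \<bullet>c u) - cnj (v \<bullet>c p) * cnj (p \<bullet>c u) / of_real r"
      unfolding form[OF v u] by simp
    also have "cnj ((P *\<^sub>v v) \<bullet>c u) = u \<bullet>c (P *\<^sub>v v)"
      using C u v cscalar_prod_commute[of u N "P *\<^sub>v v"] by simp
    also have "cnj (v \<bullet>c p) = p \<bullet>c v" using cscalar_prod_commute[OF pc v] by simp
    also have "cnj (p \<bullet>c u) = u \<bullet>c p" using cscalar_prod_commute[OF u pc] by simp
    finally show "(P' *\<^sub>v u) \<bullet>c v = u \<bullet>c (P' *\<^sub>v v)"
      using form[OF u v] selfadjD[OF sa u v] by (simp add: mult.commute)
  qed
  moreover have "0 \<le> Re ((P' *\<^sub>v v) \<bullet>c v)" if v: "v \<in> carrier_vec N" for v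
  proof -
    have "(v \<bullet>c p) * (p \<bullet>c v) = of_real ((cmod (p \<bullet>c v))\<^sup>2)"
      using cscalar_prod_commute[OF v pc] by (simp add: complex_norm_square mult.commute del: of_real_power)
    then have "Re ((P' *\<^sub>v v) \<bullet>c v) = Re ((P *\<^sub>v v) \<bullet>c v) - (cmod (p \<bullet>c v))\<^sup>2 / r"
      unfolding form[OF v v] by (simp del: of_real_power)
    moreover have "(cmod (p \<bullet>c v))\<^sup>2 \<le> r * Re ((P *\<^sub>v v) \<bullet>c v)"
      using psd_Cauchy_Schwarz[OF P unit_vec_carrier[of N m] v] mat_entry_eq_cscalar_prod[OF C m m]
      by (simp add: p_def r_def)
    ultimately show ?thesis using r(2) by (simp add: divide_le_eq mult.commute)
  qed
  ultimately show ?thesis by (simp add: psd_def)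
qed

text \<open>A positive semidefinite matrix is a sum of rank-one matrices \<open>p p*\<close> (Cholesky
  elimination), and \<open>tr (p p* Q) = p* Q p\<close>; the induction is on the number of nonzero rows.\<close>

lemma psd_trace_mult_aux:
  assumes Q: "psd N Q"
  shows "m \<le> N \<Longrightarrow> psd N P \<Longrightarrow> (\<And>a b. a < N \<Longrightarrow> b < N \<Longrightarrow> m \<le> a \<or> m \<le> b \<Longrightarrow> P $$ (a, b) = 0)
    \<Longrightarrow> mat_trace (P * Q) \<in> \<real>\<^sub>\<ge>\<^sub>0"
proof (induction m arbitrary: P)
  case 0
  have C: "P \<in> carrier_mat N N" "Q \<in> carrier_mat N N"
    using 0 Q by (auto simp: psd_def selfadj_def)
  show ?case using 0 by (simp add: mat_trace_mult[OF C])
next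
  case (Suc m P)
  have sa: "selfadj N P" and C: "P \<in> carrier_mat N N" and CQ: "Q \<in> carrier_mat N N"
    using Suc.prems(2) Q by (auto simp: psd_def selfadj_def)
  have m: "m < N" using Suc.prems(1) by simp
  have diag: "P $$ (m, m) = of_real (Re (P $$ (m, m)))" "0 \<le> Re (P $$ (m, m))"
    using selfadj_Im[OF sa unit_vec_carrier[of N m]] psd_nonneg[OF Suc.prems(2) unit_vec_carrier[of N m]]
      mat_entry_eq_cscalar_prod[OF C m m]
    by (auto simp: complex_eq_iff)
  show ?case
  proof (cases "Re (P $$ (m, m)) = 0")
    case True
    \<comment> \<open>By Cauchy-Schwarz, a vanishing diagonal entry of a positive semidefinite
      matrix annihilates its whole column, so there is nothing to eliminate.\<close>
    have row: "P $$ (a, m) = 0" if a: "a < N" for a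
      using psd_Cauchy_Schwarz[OF Suc.prems(2) unit_vec_carrier[of N m] unit_vec_carrier[of N a]]
        mat_entry_eq_cscalar_prod[OF C a m] mat_entry_eq_cscalar_prod[OF C m m] True by simp
    have "P $$ (a, b) = 0" if ab: "a < N" "b < N" "m \<le> a \<or> m \<le> b" for a b
    proof -
      consider "a = m" | "b = m" | "Suc m \<le> a" | "Suc m \<le> b" using ab(3) by linarith
      then show ?thesis
        using row ab selfadj_entry[OF sa ab(1,2)] Suc.prems(3)[OF ab(1,2)] by cases auto
    qed
    then show ?thesis using Suc.prems m by (intro Suc.IH) auto
  next
    case False
    then have pos: "0 < Re (P $$ (m, m))" using diag by simp
    define r where "r = Re (P $$ (m, m))"
    define P' where "P' = mat N N (\<lambda>(a, b). P $$ (a, b) - P $$ (a, m) * cnj (P $$ (b, m)) / P $$ (m, m))"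
    have C': "P' \<in> carrier_mat N N" by (simp add: P'_def)
    have r: "P $$ (m, m) = of_real r" "0 < r" using diag pos by (simp_all add: r_def)
    have P': "psd N P'" unfolding P'_def by (rule psd_pivot_step[OF Suc.prems(2) m pos])
    \<comment> \<open>Elimination clears row and column \<open>m\<close> and keeps the later ones
      zero, so the induction hypothesis applies to \<open>P'\<close>.\<close>
    have "P' $$ (a, b) = 0" if ab: "a < N" "b < N" "m \<le> a \<or> m \<le> b" for a b
    proof -
      have e: "P' $$ (a, b) = P $$ (a, b) - P $$ (a, m) * cnj (P $$ (b, m)) / of_real r"
        using ab by (simp add: P'_def r)
      consider "a = m" | "b = m" | "Suc m \<le> a" | "Suc m \<le> b" using ab(3) by linarith
      then show ?thesis
      proof cases
        case 1
        then show ?thesis using r selfadj_entry[OF sa ab(1,2)] unfolding e by simp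
      next
        case 2
        then show ?thesis using r unfolding e by simp
      next
        case 3
        then show ?thesis using Suc.prems(3)[of a b] Suc.prems(3)[of a m] ab m unfolding e by simp
      next
        case 4
        then show ?thesis using Suc.prems(3)[of a b] Suc.prems(3)[of b m] ab m unfolding e by simp
      qed
    qed
    then have IH: "mat_trace (P' * Q) \<in> \<real>\<^sub>\<ge>\<^sub>0"
      using P' m by (intro Suc.IH) auto
    define p where "p = P *\<^sub>v unit_vec N m"
    have pc: "p \<in> carrier_vec N" using C by (simp add: p_def)
    have pi: "p $ i = P $$ (i, m)" if "i < N" for i
      using that C m by (simp add: p_def)
    have "mat_trace (P * Q) = mat_trace (P' * Q) +
        (\<Sum>i<N. \<Sum>j<N. P $$ (i, m) * cnj (P $$ (j, m)) / of_real r * Q $$ (j, i))"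
      unfolding mat_trace_mult[OF C CQ] mat_trace_mult[OF C' CQ]
      by (simp add: P'_def r sum.distrib[symmetric] algebra_simps)
    also have "(\<Sum>i<N. \<Sum>j<N. P $$ (i, m) * cnj (P $$ (j, m)) / of_real r * Q $$ (j, i))
        = (\<Sum>j<N. \<Sum>i<N. P $$ (i, m) * cnj (P $$ (j, m)) / of_real r * Q $$ (j, i))"
      by (rule sum.swap)
    also have "\<dots> = ((Q *\<^sub>v p) \<bullet>c p) / of_real r"
    proof -
      have "(Q *\<^sub>v p) \<bullet>c p = (\<Sum>j<N. (\<Sum>i<N. Q $$ (j, i) * P $$ (i, m)) * cnj (P $$ (j, m)))"
        using CQ pc
        by (subst cscalar_prod_eq_sum[of _ N]) (auto simp: scalar_prod_def atLeast0LessThan pi)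
      then show ?thesis
        by (simp add: sum_divide_distrib sum_distrib_right sum_distrib_left mult_ac)
    qed
    also have "(Q *\<^sub>v p) \<bullet>c p = of_real (Re ((Q *\<^sub>v p) \<bullet>c p))"
      using selfadj_Im[OF psd_selfadj[OF Q] pc] by (simp add: complex_eq_iff)
    finally have "mat_trace (P * Q) = mat_trace (P' * Q) + of_real (Re ((Q *\<^sub>v p) \<bullet>c p) / r)"
      by simp
    moreover have "0 \<le> Re ((Q *\<^sub>v p) \<bullet>c p) / r" using psd_nonneg[OF Q pc] r(2) by simp
    then have "complex_of_real (Re ((Q *\<^sub>v p) \<bullet>c p) / r) \<in> \<real>\<^sub>\<ge>\<^sub>0"
      by (simp only: nonneg_Reals_of_real_iff)
    ultimately show ?thesis using IH by (simp only: nonneg_Reals_add_I)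
  qed
qed

lemma psd_trace_mult:
  assumes "psd N P" "psd N Q"
  shows "mat_trace (P * Q) \<in> \<real>\<^sub>\<ge>\<^sub>0"
  using assms(1) by (intro psd_trace_mult_aux[OF assms(2), of N]) auto

lemma psd_one: "psd N (1\<^sub>m N)"
  by (auto simp: psd_def selfadj_def Re_cscalar_prod_self)

lemma psd_trace:
  assumes "psd N P"
  shows "mat_trace P \<in> \<real>\<^sub>\<ge>\<^sub>0"
  using psd_trace_mult[OF assms psd_one] assms by (auto simp: psd_def selfadj_def)

text \<open>The form of the product at \<open>v\<close> is the form of \<open>P\<close> at
  \<open>T v\<close>. With \<open>psd_trace_mult\<close> it yields the nonnegative entries of the
  linearised system.\<close>

lemma psd_congruence:
  assumes T: "selfadj N T" and P: "psd N P"
  shows "psd N (T * (P * T))"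
proof -
  have C: "T \<in> carrier_mat N N" "P \<in> carrier_mat N N"
    using assms by (auto simp: psd_def selfadj_def)
  have eq: "(T * (P * T)) *\<^sub>v v = T *\<^sub>v (P *\<^sub>v (T *\<^sub>v v))" if "v \<in> carrier_vec N" for v
    using C that by (simp add: assoc_mult_mat_vec[of _ N N _ N])
  have "((T * (P * T)) *\<^sub>v u) \<bullet>c v = (P *\<^sub>v (T *\<^sub>v u)) \<bullet>c (T *\<^sub>v v)"
    if "u \<in> carrier_vec N" "v \<in> carrier_vec N" for u v
    using C that by (simp add: eq selfadjD[OF T])
  moreover have "u \<bullet>c ((T * (P * T)) *\<^sub>v v) = (T *\<^sub>v u) \<bullet>c (P *\<^sub>v (T *\<^sub>v v))"
    if "u \<in> carrier_vec N" "v \<in> carrier_vec N" for u v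
    using C that by (simp add: eq selfadjD[OF T, symmetric])
  ultimately show ?thesis
    using C P selfadjD[OF psd_selfadj[OF P]]
    by (auto simp: psd_def selfadj_def)
qed

section \<open>Weighted sums of matrices\<close>

text \<open>Defined entrywise to match the entrywise sum inside \<open>T_mat\<close>;
  \<open>wsum_Suc\<close> turns it into a matrix recursion for the inductions below.\<close>

definition wsum :: "nat \<Rightarrow> nat \<Rightarrow> (nat \<Rightarrow> complex) \<Rightarrow> (nat \<Rightarrow> complex mat) \<Rightarrow> complex mat" where
  "wsum N n g A = mat N N (\<lambda>(a, b). \<Sum>j<n. g j * A j $$ (a, b))"

lemma wsum_carrier [simp]: "wsum N n g A \<in> carrier_mat N N"
  by (simp add: wsum_def)

lemma wsum_0: "wsum N 0 g A = 0\<^sub>m N N"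
  by (auto simp: wsum_def)

lemma wsum_Suc:
  "A n \<in> carrier_mat N N \<Longrightarrow> wsum N (Suc n) g A = wsum N n g A + g n \<cdot>\<^sub>m A n"
  by (intro eq_matI) (auto simp: wsum_def)

lemma wsum_cong: "(\<And>j. j < n \<Longrightarrow> g j = h j) \<Longrightarrow> wsum N n g A = wsum N n h A"
  by (auto simp: wsum_def intro!: eq_matI sum.cong)

lemma wsum_diff: "wsum N n g A - wsum N n h A = wsum N n (\<lambda>j. g j - h j) A"
  by (intro eq_matI) (auto simp: wsum_def sum_subtractf left_diff_distrib)

lemma opnorm_le_wsum:
  assumes "\<And>j. j < n \<Longrightarrow> opnorm_le N K (A j)"
  shows "opnorm_le N ((\<Sum>j<n. cmod (g j)) * K) (wsum N n g A)"
  using assms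
proof (induction n)
  case 0
  then show ?case by (simp add: wsum_0 opnorm_le_zero)
next
  case (Suc n)
  then have "opnorm_le N ((\<Sum>j<n. cmod (g j)) * K + cmod (g n) * K) (wsum N n g A + g n \<cdot>\<^sub>m A n)"
    by (intro opnorm_le_add opnorm_le_smult) auto
  then show ?case using Suc.prems[of n] by (simp add: wsum_Suc opnorm_le_carrier algebra_simps)
qed

lemma wsum_form:
  assumes "\<And>j. j < n \<Longrightarrow> A j \<in> carrier_mat N N" and u: "u \<in> carrier_vec N" and v: "v \<in> carrier_vec N"
  shows "(wsum N n g A *\<^sub>v u) \<bullet>c v = (\<Sum>j<n. g j * ((A j *\<^sub>v u) \<bullet>c v))"
  using assms(1)
proof (induction n)
  case 0
  have "0\<^sub>m N N *\<^sub>v u = 0\<^sub>v N" using u by (intro eq_vecI) auto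
  then show ?case using v by (simp add: wsum_0)
next
  case (Suc n)
  have An: "A n \<in> carrier_mat N N" using Suc.prems by simp
  then have "wsum N (Suc n) g A *\<^sub>v u = wsum N n g A *\<^sub>v u + g n \<cdot>\<^sub>v (A n *\<^sub>v u)"
    using u by (simp add: wsum_Suc add_mult_distrib_mat_vec[of _ N N] smult_mat_mult_vec)
  moreover have "wsum N n g A *\<^sub>v u \<in> carrier_vec N" "A n *\<^sub>v u \<in> carrier_vec N"
    using An u by (auto intro!: mult_mat_vec_carrier[of _ _ N])
  ultimately show ?case
    using Suc v by (simp add: cscalar_prod_linear[where N = N])
qed

lemma mat_trace_wsum:
  assumes "\<And>j. j < n \<Longrightarrow> A j \<in> carrier_mat N N" and B: "B \<in> carrier_mat N N" and C: "C \<in> carrier_mat N N"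
  shows "mat_trace (B * (wsum N n g A * C)) = (\<Sum>j<n. g j * mat_trace (B * (A j * C)))"
  using assms(1)
proof (induction n)
  case 0
  then show ?case using B C by (simp add: wsum_0 mat_trace_zero)
next
  case (Suc n)
  have An: "A n \<in> carrier_mat N N" using Suc.prems by simp
  have "wsum N n g A * C \<in> carrier_mat N N" "A n * C \<in> carrier_mat N N"
    using An C by (auto intro!: mult_carrier_mat[of _ N N])
  then have "B * (wsum N (Suc n) g A * C) = B * (wsum N n g A * C) + g n \<cdot>\<^sub>m (B * (A n * C))"
    using B C An
    by (simp add: wsum_Suc add_mult_distrib_mat[of _ N N _ _ N] mult_add_distrib_mat[of _ N N _ N]
        mult_smult_assoc_mat[of _ N N _ N] mult_smult_distrib[of _ N N _ N])
  moreover have "B * (wsum N n g A * C) \<in> carrier_mat N N" "B * (A n * C) \<in> carrier_mat N N"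
    using An B C by (auto intro!: mult_carrier_mat[of _ N N])
  ultimately show ?case
    using Suc by (simp add: mat_trace_add[of _ N] mat_trace_smult[of _ N])
qed

text \<open>Everything rests on \<open>u = T0 (S u) + T0 ((S0 - S) u)\<close>. Its last term has at
  most half the norm of \<open>u\<close>, so \<open>nrm u \<le> 2 * nrm (T0 (S u))\<close>: hence
  \<open>S\<close> is injective and its inverse is bounded.\<close>

lemma mat_inverse_perturbation:
  assumes S0: "S0 \<in> carrier_mat N N" and T0: "opnorm_le N \<tau> T0" "T0 * S0 = 1\<^sub>m N"
    and S: "S \<in> carrier_mat N N" and M: "opnorm_le N \<kappa> (S0 - S)" and small: "\<tau> * \<kappa> \<le> 1 / 2" and N: "0 < N"
  shows "det S \<noteq> 0" "opnorm_le N (2 * \<tau>) (inv_mat S)" "opnorm_le N (2 * \<tau>\<^sup>2 * \<kappa>) (inv_mat S - T0)"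
proof -
  have T0c: "T0 \<in> carrier_mat N N" using T0(1) by (rule opnorm_le_carrier)
  have \<tau>: "0 \<le> \<tau>" and \<kappa>: "0 \<le> \<kappa>" using opnorm_le_nonneg[OF T0(1) N] opnorm_le_nonneg[OF M N] by auto
  have Mc: "S0 - S \<in> carrier_mat N N" using M by (rule opnorm_le_carrier)
  have key: "u = T0 *\<^sub>v (S *\<^sub>v u) + T0 *\<^sub>v ((S0 - S) *\<^sub>v u)" if u: "u \<in> carrier_vec N" for u
  proof -
    have "T0 *\<^sub>v (S *\<^sub>v u) + T0 *\<^sub>v ((S0 - S) *\<^sub>v u) = T0 *\<^sub>v (S *\<^sub>v u + (S0 - S) *\<^sub>v u)"
      using T0c S S0 u Mc by (subst mult_add_distrib_mat_vec[of _ N N]) auto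
    also have "S *\<^sub>v u + (S0 - S) *\<^sub>v u = S0 *\<^sub>v u"
      using S S0 u by (subst minus_mult_distrib_mat_vec[of _ N N]) (auto intro!: eq_vecI)
    also have "T0 *\<^sub>v (S0 *\<^sub>v u) = u"
      using T0c S0 u T0(2) by (metis assoc_mult_mat_vec one_mult_mat_vec)
    finally show ?thesis by simp
  qed
  have rest: "nrm (T0 *\<^sub>v ((S0 - S) *\<^sub>v u)) \<le> \<tau> * \<kappa> * nrm u" if u: "u \<in> carrier_vec N" for u
    using opbD[OF T0(1), of "(S0 - S) *\<^sub>v u"] mult_left_mono[OF opbD[OF M u] \<tau>] Mc u
    by (simp add: mult.assoc)
  have half: "nrm u \<le> 2 * nrm (T0 *\<^sub>v (S *\<^sub>v u))" if u: "u \<in> carrier_vec N" for u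
  proof -
    have "nrm u \<le> nrm (T0 *\<^sub>v (S *\<^sub>v u)) + nrm (T0 *\<^sub>v ((S0 - S) *\<^sub>v u))"
      using T0c S Mc u by (subst key[OF u], intro nrm_add[of _ N]) auto
    also have "nrm (T0 *\<^sub>v ((S0 - S) *\<^sub>v u)) \<le> 1 / 2 * nrm u"
      using rest[OF u] mult_right_mono[OF small nrm_nonneg[of u]] by linarith
    finally show ?thesis by simp
  qed
  show d: "det S \<noteq> 0"
  proof
    assume "det S = 0"
    then obtain v where v: "v \<in> carrier_vec N" "v \<noteq> 0\<^sub>v N" "S *\<^sub>v v = 0\<^sub>v N"
      using det_0_iff_vec_prod_zero[OF S] by auto
    have "T0 *\<^sub>v 0\<^sub>v N = 0\<^sub>v N" using T0c by (intro eq_vecI) auto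
    then have "nrm v \<le> 0" using half[OF v(1)] v(3) nrm_eq_0_iff[of "0\<^sub>v N" N] by simp
    then have "nrm v = 0" using nrm_nonneg[of v] by linarith
    then show False using v nrm_eq_0_iff[OF v(1)] by simp
  qed
  note inv = det_nonzero_inverse[OF S d]
  have ST: "S *\<^sub>v (inv_mat S *\<^sub>v v) = v" if "v \<in> carrier_vec N" for v
    using inv S that by (metis assoc_mult_mat_vec one_mult_mat_vec)
  have b2: "nrm (inv_mat S *\<^sub>v v) \<le> 2 * \<tau> * nrm v" if v: "v \<in> carrier_vec N" for v
    using half[of "inv_mat S *\<^sub>v v"] ST[OF v] opbD[OF T0(1) v] inv(1) v by simp
  then show "opnorm_le N (2 * \<tau>) (inv_mat S)" using inv(1) by (auto simp: opnorm_le_def)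
  have "nrm ((inv_mat S - T0) *\<^sub>v v) \<le> 2 * \<tau>\<^sup>2 * \<kappa> * nrm v" if v: "v \<in> carrier_vec N" for v
  proof -
    define u where "u = inv_mat S *\<^sub>v v"
    have u: "u \<in> carrier_vec N" using inv(1) v by (simp add: u_def)
    have "(inv_mat S - T0) *\<^sub>v v = u - T0 *\<^sub>v v"
      unfolding u_def using inv(1) T0c v by (subst minus_mult_distrib_mat_vec[of _ N N]) auto
    \<comment> \<open>The same identity at \<open>u = inv_mat S v\<close> is the resolvent identity
      applied to a vector.\<close>
    also have "u - T0 *\<^sub>v v = T0 *\<^sub>v ((S0 - S) *\<^sub>v u)"
    proof -
      have "u = T0 *\<^sub>v v + T0 *\<^sub>v ((S0 - S) *\<^sub>v u)"
        using key[OF u] ST[OF v] by (simp add: u_def)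
      moreover have "T0 *\<^sub>v v + x - T0 *\<^sub>v v = x" if "x \<in> carrier_vec N" for x
        using that T0c v by (intro eq_vecI) auto
      moreover have "T0 *\<^sub>v ((S0 - S) *\<^sub>v u) \<in> carrier_vec N" using T0c Mc u by simp
      ultimately show ?thesis by metis
    qed
    also have "nrm \<dots> \<le> \<tau> * \<kappa> * nrm u" by (rule rest[OF u])
    also have "\<dots> \<le> \<tau> * \<kappa> * (2 * \<tau> * nrm v)"
      using b2[OF v] \<tau> \<kappa> by (intro mult_left_mono) (auto simp: u_def)
    finally show ?thesis by (simp add: power2_eq_square mult_ac)
  qed
  then show "opnorm_le N (2 * \<tau>\<^sup>2 * \<kappa>) (inv_mat S - T0)"
    using inv(1) T0c by (auto simp: opnorm_le_def minus_carrier_mat)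
qed

lemma resolvent_identity:
  fixes S S' :: "complex mat"
  assumes S: "S \<in> carrier_mat N N" and S': "S' \<in> carrier_mat N N"
    and T: "T \<in> carrier_mat N N" and T': "T' \<in> carrier_mat N N"
    and "T * S = 1\<^sub>m N" "S' * T' = 1\<^sub>m N"
  shows "T - T' = T * ((S' - S) * T')"
proof -
  have "T * ((S' - S) * T') = T * (S' * T') - T * (S * T')"
    using S S' T T' by (simp add: minus_mult_distrib_mat[of _ N N _ _ N] mult_minus_distrib_mat[of _ N N _ N])
  also have "T * (S * T') = (T * S) * T'" using S T T' by simp
  finally show ?thesis using assms by simp
qed

text \<open>Telescoping: first the left and then the right factor is exchanged for
  \<open>T0\<close>. It splits a resolvent difference into its linearisation at the base point and a
  remainder that is small both in \<open>Y\<close> and in the distance to \<open>T0\<close>.\<close>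

lemma triple_product_perturbation:
  fixes T T' T0 Y :: "complex mat"
  assumes "T \<in> carrier_mat N N" "T' \<in> carrier_mat N N" "T0 \<in> carrier_mat N N" "Y \<in> carrier_mat N N"
  shows "T * (Y * T') = T0 * (Y * T0) + ((T - T0) * (Y * T') + T0 * (Y * (T' - T0)))"
proof -
  have eq: "A + ((B - C) + (C - A)) = B"
    if "A \<in> carrier_mat N N" "B \<in> carrier_mat N N" "C \<in> carrier_mat N N" for A B C :: "complex mat"
    using that by (intro eq_matI) auto
  have "T0 * (Y * T0) + ((T * (Y * T') - T0 * (Y * T')) + (T0 * (Y * T') - T0 * (Y * T0))) = T * (Y * T')"
    using assms by (intro eq) auto
  then show ?thesis
    using assms by (simp add: minus_mult_distrib_mat[of _ N N _ _ N] mult_minus_distrib_mat[of _ N N _ N])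
qed

section \<open>The system on the negative half-line\<close>

lemma Re_of_real_times: "Re (complex_of_real r * z) = r * Re z"
  by simp

text \<open>One member of the sequence. The constants \<open>w\<close>, \<open>W\<close>,
  \<open>\<beta>\<close> are parameters because they will be common to all large members: bounds
  expressed in them alone are uniform. \<open>\<beta>\<close> is a lower bound for
  \<open>1 - N/n\<close>, and the eigenvalue bounds enter as bounds on the forms.\<close>

locale det_equiv =
  fixes N n :: nat and \<Omega> :: "nat \<Rightarrow> complex mat" and \<delta> :: "nat \<Rightarrow> complex \<Rightarrow> complex"
    and w W \<beta> :: real
  assumes N_pos: "0 < N" and N_le: "real N \<le> (1 - \<beta>) * real n"
    and \<beta>_pos: "0 < \<beta>" and w_pos: "0 < w" and W_pos: "0 < W"
    and \<Omega>_selfadj: "\<And>i. i < n \<Longrightarrow> selfadj N (\<Omega> i)"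
    and \<Omega>_lower: "\<And>i v. i < n \<Longrightarrow> v \<in> carrier_vec N \<Longrightarrow> w * (nrm v)\<^sup>2 \<le> Re ((\<Omega> i *\<^sub>v v) \<bullet>c v)"
    and \<Omega>_upper: "\<And>i v. i < n \<Longrightarrow> v \<in> carrier_vec N \<Longrightarrow> Re ((\<Omega> i *\<^sub>v v) \<bullet>c v) \<le> W * (nrm v)\<^sup>2"
    and solution: "delta_solution N n \<Omega> \<delta>"
begin

definition avg :: "(nat \<Rightarrow> complex) \<Rightarrow> complex mat" where
  "avg g = wsum N n (\<lambda>j. g j / of_nat n) \<Omega>"

definition S :: "complex \<Rightarrow> complex mat" where
  "S z = avg (\<lambda>j. 1 / (1 + \<delta> j z)) - z \<cdot>\<^sub>m 1\<^sub>m N"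

abbreviation T :: "complex \<Rightarrow> complex mat" where
  "T z \<equiv> T_mat N n \<Omega> \<delta> z"

text \<open>The norm bound for \<open>T\<close> at negative points, established in
  \<open>opnorm_le_T0\<close>.\<close>

definition \<tau> :: real where "\<tau> = 1 / (w * \<beta>)"

lemma \<tau>_pos: "0 < \<tau>"
  using w_pos \<beta>_pos by (simp add: \<tau>_def)

lemma n_pos: "0 < n"
  using N_pos N_le by (cases n) auto

lemma N_le_n: "real N \<le> real n"
proof -
  have "\<beta> * real n \<ge> 0" using \<beta>_pos by simp
  then show ?thesis using N_le by (simp add: left_diff_distrib)
qed

lemma T_eq: "T z = inv_mat (S z)"
proof -
  have "mat N N (\<lambda>(a, b). (1 / of_nat n) * (\<Sum>j<n. (\<Omega> j $$ (a, b)) / (1 + \<delta> j z)) - (if a = b then z else 0)) = S z"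
    by (intro eq_matI) (auto simp: S_def avg_def wsum_def sum_distrib_left mult.commute)
  then show ?thesis by (simp add: T_mat_def)
qed

lemma avg_carrier [simp]: "avg g \<in> carrier_mat N N"
  by (simp add: avg_def)

lemma S_carrier [simp]: "S z \<in> carrier_mat N N"
  unfolding S_def by (intro minus_carrier_mat) auto

lemma \<Omega>_carrier: "i < n \<Longrightarrow> \<Omega> i \<in> carrier_mat N N"
  using \<Omega>_selfadj selfadj_carrier by blast

lemma \<Omega>_psd: "i < n \<Longrightarrow> psd N (\<Omega> i)"
  unfolding psd_def using \<Omega>_selfadj \<Omega>_lower w_pos
  by (meson order.trans mult_nonneg_nonneg less_imp_le zero_le_power2)

lemma opnorm_le_\<Omega>: "i < n \<Longrightarrow> opnorm_le N W (\<Omega> i)"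
  using opnorm_le_of_form_bound[OF \<Omega>_psd \<Omega>_upper] W_pos by simp

lemma opnorm_le_avg:
  assumes "\<And>j. j < n \<Longrightarrow> cmod (g j) \<le> K"
  shows "opnorm_le N (K * W) (avg g)"
proof -
  have "(\<Sum>j<n. cmod (g j / of_nat n)) \<le> (\<Sum>j<n. K / real n)"
    using assms n_pos by (intro sum_mono) (simp add: norm_divide divide_right_mono)
  also have "\<dots> = K" using n_pos by simp
  finally show ?thesis
    unfolding avg_def using W_pos
    by (intro opnorm_le_mono[OF opnorm_le_wsum[OF opnorm_le_\<Omega>]]) (auto intro: mult_right_mono)
qed

lemma avg_diff: "avg g - avg h = avg (\<lambda>j. g j - h j)"
  by (simp add: avg_def wsum_diff diff_divide_distrib)

lemma S_diff: "S z - S z' = avg (\<lambda>j. 1 / (1 + \<delta> j z) - 1 / (1 + \<delta> j z')) + (z' - z) \<cdot>\<^sub>m 1\<^sub>m N"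
proof -
  have "S z - S z' = (avg (\<lambda>j. 1 / (1 + \<delta> j z)) - avg (\<lambda>j. 1 / (1 + \<delta> j z'))) + (z' - z) \<cdot>\<^sub>m 1\<^sub>m N"
    unfolding S_def using avg_carrier by (intro eq_matI) (auto simp: avg_def wsum_def)
  then show ?thesis by (simp add: avg_diff)
qed

lemma mat_trace_avg:
  assumes "B \<in> carrier_mat N N" "C \<in> carrier_mat N N"
  shows "mat_trace (B * (avg g * C)) = (\<Sum>j<n. g j / of_nat n * mat_trace (B * (\<Omega> j * C)))"
  unfolding avg_def by (intro mat_trace_wsum \<Omega>_carrier assms)

lemma \<delta>_eq: "z \<notin> Rplus \<Longrightarrow> i < n \<Longrightarrow> \<delta> i z = mat_trace (\<Omega> i * T z) / of_nat n"
  using solution by (simp add: delta_solution_def)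

lemma not_Rplus_neg: "x < 0 \<Longrightarrow> complex_of_real x \<notin> Rplus"
  by (auto simp: Rplus_def)

text \<open>At \<open>x < 0\<close> the kernel \<open>1 / (t - x)\<close> is real, and it is
  nonnegative for almost every \<open>t\<close> because the representing measure does not charge the
  negative half-line.\<close>

lemma \<delta>_neg_real:
  assumes "x < 0" "i < n"
  shows "\<delta> i (of_real x) = of_real (Re (\<delta> i (of_real x)))" "0 \<le> Re (\<delta> i (of_real x))"
proof -
  obtain \<nu> where \<nu>: "finite_meas_Rplus \<nu>" "\<And>z. z \<notin> Rplus \<Longrightarrow> \<delta> i z = stieltjes \<nu> z"
    using solution assms(2) by (auto simp: delta_solution_def is_stieltjes_Rplus_def)
  have "stieltjes \<nu> (of_real x) = (\<integral>t. complex_of_real (1 / (t - x)) \<partial>\<nu>)"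
    by (simp add: stieltjes_def)
  also have "\<dots> = of_real (\<integral>t. 1 / (t - x) \<partial>\<nu>)"
    by (rule integral_complex_of_real)
  finally have eq: "\<delta> i (of_real x) = of_real (\<integral>t. 1 / (t - x) \<partial>\<nu>)"
    using \<nu>(2)[OF not_Rplus_neg[OF assms(1)]] by simp
  have "AE t in \<nu>. t \<notin> {..<0}"
    using \<nu>(1) by (intro AE_not_in) (auto simp: finite_meas_Rplus_def null_sets_def)
  then have "0 \<le> (\<integral>t. 1 / (t - x) \<partial>\<nu>)"
    using assms(1) by (intro integral_nonneg_AE) (auto elim!: eventually_mono)
  then show "\<delta> i (of_real x) = of_real (Re (\<delta> i (of_real x)))" "0 \<le> Re (\<delta> i (of_real x))"
    using eq by auto
qed

end

section \<open>Bounds at a fixed negative base point\<close>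

locale det_equiv_base = det_equiv +
  fixes x0 :: real
  assumes x0_neg: "x0 < 0"
begin

definition d :: "nat \<Rightarrow> real" where "d j = Re (\<delta> j (of_real x0))"
definition S0 :: "complex mat" where "S0 = S (of_real x0)"
definition T0 :: "complex mat" where "T0 = T (of_real x0)"
text \<open>The total weight of the matrices \<open>\<Omega> j\<close> in \<open>S0\<close>, so that
  \<open>w * \<alpha>\<close> bounds \<open>S0\<close> from below.\<close>

definition \<alpha> :: real where "\<alpha> = (\<Sum>j<n. 1 / (1 + d j)) / real n"

lemma \<delta>_x0: "i < n \<Longrightarrow> \<delta> i (of_real x0) = of_real (d i)"
  using \<delta>_neg_real[OF x0_neg] by (simp add: d_def)

lemma d_nonneg: "i < n \<Longrightarrow> 0 \<le> d i"
  using \<delta>_neg_real[OF x0_neg] by (simp add: d_def)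

lemma \<alpha>_pos: "0 < \<alpha>"
  unfolding \<alpha>_def using n_pos d_nonneg
  by (auto intro!: divide_pos_pos sum_pos add_pos_nonneg simp: lessThan_empty_iff)

lemma S0_carrier: "S0 \<in> carrier_mat N N"
  by (simp add: S0_def)

lemma S0_eq: "S0 = avg (\<lambda>j. of_real (1 / (1 + d j))) - of_real x0 \<cdot>\<^sub>m 1\<^sub>m N"
  unfolding S0_def S_def avg_def
  by (intro arg_cong2[where f = "(-)"] wsum_cong refl) (simp add: \<delta>_x0)

lemma S0_form:
  assumes u: "u \<in> carrier_vec N" and v: "v \<in> carrier_vec N"
  shows "(S0 *\<^sub>v u) \<bullet>c v = (\<Sum>j<n. of_real (1 / (1 + d j) / real n) * ((\<Omega> j *\<^sub>v u) \<bullet>c v)) - of_real x0 * (u \<bullet>c v)"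
proof -
  have "S0 *\<^sub>v u = avg (\<lambda>j. of_real (1 / (1 + d j))) *\<^sub>v u - of_real x0 \<cdot>\<^sub>v u"
    unfolding S0_eq using u
    by (subst minus_mult_distrib_mat_vec[of _ N N]) (auto simp: smult_mat_mult_vec)
  moreover have "avg (\<lambda>j. of_real (1 / (1 + d j))) *\<^sub>v u \<in> carrier_vec N"
    using u by (intro mult_mat_vec_carrier[of _ N N]) auto
  moreover have "(avg (\<lambda>j. of_real (1 / (1 + d j))) *\<^sub>v u) \<bullet>c v
      = (\<Sum>j<n. of_real (1 / (1 + d j) / real n) * ((\<Omega> j *\<^sub>v u) \<bullet>c v))"
    unfolding avg_def using \<Omega>_carrier u v by (subst wsum_form) auto
  ultimately show ?thesis using u v by (simp add: cscalar_prod_linear[where N = N])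
qed

lemma S0_selfadj: "selfadj N S0"
  unfolding selfadj_def
proof (intro conjI ballI S0_carrier)
  fix u v :: "complex vec" assume u: "u \<in> carrier_vec N" and v: "v \<in> carrier_vec N"
  have cn: "cnj ((\<Omega> j *\<^sub>v v) \<bullet>c u) = (\<Omega> j *\<^sub>v u) \<bullet>c v" if "j < n" for j
    using cscalar_prod_commute[of u N "\<Omega> j *\<^sub>v v"] selfadjD[OF \<Omega>_selfadj[OF that] u v] u v \<Omega>_carrier[OF that]
    by simp
  have "u \<bullet>c (S0 *\<^sub>v v) = cnj ((S0 *\<^sub>v v) \<bullet>c u)"
    using u v S0_carrier by (intro cscalar_prod_commute) auto
  also have "\<dots> = (S0 *\<^sub>v u) \<bullet>c v"
    unfolding S0_form[OF u v] S0_form[OF v u] using cn cscalar_prod_commute[OF u v] by simp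
  finally show "(S0 *\<^sub>v u) \<bullet>c v = u \<bullet>c (S0 *\<^sub>v v)" by simp
qed

text \<open>The shift by \<open>- x0 > 0\<close> only increases the form and is dropped; this keeps
  the bound usable as \<open>x0\<close> approaches 0.\<close>

lemma S0_lower:
  assumes v: "v \<in> carrier_vec N"
  shows "w * \<alpha> * (nrm v)\<^sup>2 \<le> Re ((S0 *\<^sub>v v) \<bullet>c v)"
proof -
  have "w * \<alpha> * (nrm v)\<^sup>2 = (\<Sum>j<n. 1 / (1 + d j) / real n * (w * (nrm v)\<^sup>2))"
    by (simp add: \<alpha>_def sum_distrib_left sum_distrib_right sum_divide_distrib mult_ac)
  also have "\<dots> \<le> (\<Sum>j<n. 1 / (1 + d j) / real n * Re ((\<Omega> j *\<^sub>v v) \<bullet>c v))"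
    using d_nonneg \<Omega>_lower v by (intro sum_mono mult_left_mono) auto
  also have "\<dots> \<le> (\<Sum>j<n. 1 / (1 + d j) / real n * Re ((\<Omega> j *\<^sub>v v) \<bullet>c v)) - x0 * (nrm v)\<^sup>2"
    using x0_neg by (simp add: mult_nonpos_nonneg)
  also have "\<dots> = Re ((S0 *\<^sub>v v) \<bullet>c v)"
    unfolding S0_form[OF v v] by (simp only: minus_complex.sel Re_sum Re_of_real_times Re_cscalar_prod_self[OF v])
  finally show ?thesis .
qed

lemma det_S0: "det S0 \<noteq> 0"
proof
  assume "det S0 = 0"
  then obtain v where v: "v \<in> carrier_vec N" "v \<noteq> 0\<^sub>v N" "S0 *\<^sub>v v = 0\<^sub>v N"
    using det_0_iff_vec_prod_zero[OF S0_carrier] by auto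
  have "0 < w * \<alpha>" using w_pos \<alpha>_pos by simp
  moreover have "w * \<alpha> * (nrm v)\<^sup>2 \<le> 0" using S0_lower[OF v(1)] v by simp
  ultimately have "(nrm v)\<^sup>2 \<le> 0" by (meson mult_pos_pos not_le)
  then have "nrm v = 0" by simp
  then show False using v nrm_eq_0_iff by blast
qed

lemma T0_carrier: "T0 \<in> carrier_mat N N" and S0_T0: "S0 * T0 = 1\<^sub>m N" and T0_S0: "T0 * S0 = 1\<^sub>m N"
  using det_nonzero_inverse[OF S0_carrier det_S0] by (simp_all add: T0_def T_eq S0_def)

lemma S0_T0_vec: "v \<in> carrier_vec N \<Longrightarrow> S0 *\<^sub>v (T0 *\<^sub>v v) = v"
  using S0_T0 S0_carrier T0_carrier by (metis assoc_mult_mat_vec one_mult_mat_vec)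

lemma T0_selfadj: "selfadj N T0"
  unfolding selfadj_def
proof (intro conjI ballI T0_carrier)
  fix u v :: "complex vec" assume u: "u \<in> carrier_vec N" and v: "v \<in> carrier_vec N"
  then show "(T0 *\<^sub>v u) \<bullet>c v = u \<bullet>c (T0 *\<^sub>v v)"
    using selfadjD[OF S0_selfadj, of "T0 *\<^sub>v u" "T0 *\<^sub>v v"] S0_T0_vec T0_carrier by simp
qed

lemma T0_psd: "psd N T0"
  unfolding psd_def
proof (intro conjI ballI T0_selfadj)
  fix v :: "complex vec" assume v: "v \<in> carrier_vec N"
  then have Tv: "T0 *\<^sub>v v \<in> carrier_vec N" using T0_carrier by simp
  have "0 \<le> w * \<alpha> * (nrm (T0 *\<^sub>v v))\<^sup>2" using w_pos \<alpha>_pos by simp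
  also have "\<dots> \<le> Re ((S0 *\<^sub>v (T0 *\<^sub>v v)) \<bullet>c (T0 *\<^sub>v v))" by (rule S0_lower[OF Tv])
  also have "\<dots> = Re ((T0 *\<^sub>v v) \<bullet>c v)"
    using S0_T0_vec[OF v] selfadjD[OF T0_selfadj v v] by simp
  finally show "0 \<le> Re ((T0 *\<^sub>v v) \<bullet>c v)" .
qed

lemma trace_\<Omega>_T0: "i < n \<Longrightarrow> mat_trace (\<Omega> i * T0) = of_real (real n * d i)"
  using \<delta>_eq[OF not_Rplus_neg[OF x0_neg], of i] \<delta>_x0[of i] n_pos by (simp add: T0_def field_simps)

text \<open>The trace of \<open>S0 * T0 = 1\<close> reads
  \<open>N = (\<Sum>j<n. d j / (1 + d j)) - x0 tr T0\<close>. The last contribution is nonnegative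
  and the sum equals \<open>n - n \<alpha>\<close>, whence \<open>n - n \<alpha> \<le> N\<close>.
  This is where the gap between \<open>N/n\<close> and 1 enters.\<close>

lemma \<beta>_le_\<alpha>: "\<beta> \<le> \<alpha>"
proof -
  \<comment> \<open>The identity matrix in front brings the product into the shape
    \<open>B * (avg g * C)\<close> that \<open>mat_trace_avg\<close> expects.\<close>
  have "of_nat N = mat_trace (1\<^sub>m N * (S0 * T0))"
    by (simp add: S0_T0 mat_trace_one)
  also have "\<dots> = mat_trace (1\<^sub>m N * (avg (\<lambda>j. of_real (1 / (1 + d j))) * T0)) - of_real x0 * mat_trace T0"
  proof -
    have "avg (\<lambda>j. of_real (1 / (1 + d j))) * T0 \<in> carrier_mat N N"
      using T0_carrier by (intro mult_carrier_mat[of _ N N]) auto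
    then have "1\<^sub>m N * (avg (\<lambda>j. of_real (1 / (1 + d j))) * T0) = avg (\<lambda>j. of_real (1 / (1 + d j))) * T0"
      "avg (\<lambda>j. of_real (1 / (1 + d j))) * T0 \<in> carrier_mat N N"
      by (auto intro: left_mult_one_mat)
    then show ?thesis
      unfolding S0_eq using T0_carrier
      by (simp add: minus_mult_distrib_mat[of _ N N _ _ N] mult_smult_assoc_mat[of _ N N _ N]
        mat_trace_diff[of _ N] mat_trace_smult[of _ N])
  qed
  also have "mat_trace (1\<^sub>m N * (avg (\<lambda>j. of_real (1 / (1 + d j))) * T0))
      = (\<Sum>j<n. of_real (1 / (1 + d j)) / of_nat n * mat_trace (1\<^sub>m N * (\<Omega> j * T0)))"
    using T0_carrier by (intro mat_trace_avg) auto
  also have "\<dots> = (\<Sum>j<n. of_real (d j / (1 + d j)))"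
  proof (intro sum.cong refl)
    fix j assume "j \<in> {..<n}"
    then have j: "j < n" by simp
    have "1\<^sub>m N * (\<Omega> j * T0) = \<Omega> j * T0"
      using \<Omega>_carrier[OF j] T0_carrier by simp
    then show "of_real (1 / (1 + d j)) / of_nat n * mat_trace (1\<^sub>m N * (\<Omega> j * T0)) = complex_of_real (d j / (1 + d j))"
      using trace_\<Omega>_T0[OF j] n_pos by simp
  qed
  finally have "Re (of_nat N) = Re ((\<Sum>j<n. of_real (d j / (1 + d j))) - of_real x0 * mat_trace T0)"
    by simp
  then have "real N = (\<Sum>j<n. d j / (1 + d j)) - x0 * Re (mat_trace T0)"
    by (simp add: Re_sum del: of_real_divide)
  moreover have "x0 * Re (mat_trace T0) \<le> 0"
    using psd_trace[OF T0_psd] x0_neg by (auto simp: complex_nonneg_Reals_iff intro: mult_nonpos_nonneg)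
  moreover have "(\<Sum>j<n. d j / (1 + d j)) = real n - (\<Sum>j<n. 1 / (1 + d j))"
  proof -
    have "(\<Sum>j<n. d j / (1 + d j)) + (\<Sum>j<n. 1 / (1 + d j)) = (\<Sum>j<n. 1)"
      unfolding sum.distrib[symmetric]
    proof (intro sum.cong refl)
      fix j assume "j \<in> {..<n}"
      then have "0 < 1 + d j" using d_nonneg[of j] by simp
      then show "d j / (1 + d j) + 1 / (1 + d j) = 1" by (simp add: add_divide_distrib[symmetric] add.commute)
    qed
    then show ?thesis by simp
  qed
  ultimately have "\<beta> * real n \<le> (\<Sum>j<n. 1 / (1 + d j))"
    using N_le by (simp add: left_diff_distrib)
  then show ?thesis using n_pos by (simp add: \<alpha>_def field_simps)
qed

text \<open>Coercivity of \<open>S0\<close> at the vector \<open>T0 v\<close>, where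
  \<open>S0 (T0 v) = v\<close>, and cancellation of one factor \<open>nrm (T0 v)\<close>. The bound
  is free of \<open>x0\<close>.\<close>

lemma opnorm_le_T0: "opnorm_le N \<tau> T0"
proof -
  have "nrm (T0 *\<^sub>v v) \<le> \<tau> * nrm v" if v: "v \<in> carrier_vec N" for v
  proof -
    have Tv: "T0 *\<^sub>v v \<in> carrier_vec N" using T0_carrier v by simp
    have "w * \<beta> * (nrm (T0 *\<^sub>v v))\<^sup>2 \<le> w * \<alpha> * (nrm (T0 *\<^sub>v v))\<^sup>2"
      using w_pos \<beta>_le_\<alpha> by (intro mult_right_mono mult_left_mono) auto
    also have "\<dots> \<le> Re ((S0 *\<^sub>v (T0 *\<^sub>v v)) \<bullet>c (T0 *\<^sub>v v))" by (rule S0_lower[OF Tv])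
    also have "\<dots> \<le> nrm v * nrm (T0 *\<^sub>v v)"
      using cmod_cscalar_prod_le[OF v Tv] complex_Re_le_cmod[of "v \<bullet>c (T0 *\<^sub>v v)"]
      by (simp add: S0_T0_vec[OF v])
    finally have *: "w * \<beta> * nrm (T0 *\<^sub>v v) * nrm (T0 *\<^sub>v v) \<le> nrm v * nrm (T0 *\<^sub>v v)"
      by (simp add: power2_eq_square mult_ac)
    show ?thesis
    proof (cases "nrm (T0 *\<^sub>v v) = 0")
      case True
      then show ?thesis using \<tau>_pos by simp
    next
      case False
      then have "0 < nrm (T0 *\<^sub>v v)" using nrm_nonneg[of "T0 *\<^sub>v v"] by linarith
      from mult_right_le_imp_le[OF * this] show ?thesis
        using w_pos \<beta>_pos by (simp add: \<tau>_def field_simps)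
    qed
  qed
  then show ?thesis using T0_carrier by (simp add: opnorm_le_def)
qed

text \<open>The trace has \<open>N\<close> terms but is divided by \<open>n\<close>;
  \<open>N \<le> n\<close> absorbs the mismatch.\<close>

lemma trace_bound:
  assumes "opnorm_le N K A"
  shows "cmod (mat_trace A / of_nat n) \<le> K"
proof -
  have K: "0 \<le> K" using assms N_pos by (rule opnorm_le_nonneg)
  have "cmod (mat_trace A) \<le> real n * K"
    using cmod_mat_trace_le[OF assms] mult_right_mono[OF N_le_n K] by linarith
  then show ?thesis using n_pos by (simp add: norm_divide divide_le_eq mult.commute)
qed

lemma d_le: "i < n \<Longrightarrow> d i \<le> W * \<tau>"
  using trace_bound[OF opnorm_le_mult[OF opnorm_le_\<Omega> opnorm_le_T0], of i] W_pos n_pos d_nonneg[of i]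
  by (simp add: trace_\<Omega>_T0)

text \<open>\<open>t / (1 + t)\<close> is increasing. The bound is below 1 uniformly in
  \<open>i\<close> and \<open>x0\<close>, which makes the linearised system a strict contraction in
  the weighted sup norm.\<close>

lemma d_ratio_le: "i < n \<Longrightarrow> d i / (1 + d i) \<le> W * \<tau> / (1 + W * \<tau>)"
  using d_le[of i] d_nonneg[of i] by (simp add: field_simps)

text \<open>The linearised system is a contraction: its matrix is entrywise nonnegative and maps the
  vector \<open>1 + d\<close> below \<open>d\<close>.\<close>

lemma linearised_bound:
  assumes i: "i < n" and f: "\<And>j. j < n \<Longrightarrow> cmod (f j) \<le> E"
  shows "cmod (mat_trace (\<Omega> i * (T0 * (avg (\<lambda>j. f j / of_real (1 + d j)) * T0))) / of_nat n) \<le> E * d i"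
proof -
  note C = \<Omega>_carrier[OF i] T0_carrier
  have E: "0 \<le> E" using f[OF i] by (meson norm_ge_zero order.trans)
  have re: "\<Omega> i * (T0 * (X * T0)) = (\<Omega> i * T0) * (X * T0)" if "X \<in> carrier_mat N N" for X
    using that C by (intro assoc_mult_mat[symmetric, of _ N N _ N _ N]) auto
  \<comment> \<open>Row \<open>i\<close> of the linearised system before normalisation; its entries
    are nonnegative as traces of products of two positive semidefinite matrices.\<close>
  define a where "a j = Re (mat_trace (\<Omega> i * (T0 * (\<Omega> j * T0))))" for j
  have a: "mat_trace (\<Omega> i * (T0 * (\<Omega> j * T0))) = of_real (a j)" "0 \<le> a j" if j: "j < n" for j
    using psd_trace_mult[OF \<Omega>_psd[OF i] psd_congruence[OF T0_selfadj \<Omega>_psd[OF j]]]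
    by (auto simp: a_def complex_nonneg_Reals_iff complex_eq_iff)
  have exp: "mat_trace (\<Omega> i * (T0 * (avg g * T0))) = (\<Sum>j<n. g j / of_nat n * of_real (a j))" for g
  proof -
    have "mat_trace ((\<Omega> i * T0) * (avg g * T0)) = (\<Sum>j<n. g j / of_nat n * mat_trace ((\<Omega> i * T0) * (\<Omega> j * T0)))"
      using C by (intro mat_trace_avg) auto
    also have "\<dots> = (\<Sum>j<n. g j / of_nat n * of_real (a j))"
      using a \<Omega>_carrier by (intro sum.cong refl) (simp add: re[symmetric])
    finally show ?thesis by (simp add: re)
  qed
  \<comment> \<open>The weighted row sum is computed exactly: the weighted average of the
    \<open>\<Omega> j\<close> is \<open>S0 + x0\<close>, and
    \<open>T0 (S0 + x0) T0 = T0 + x0 T0^2\<close>, where the second term contributes a nonpositive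
    trace.\<close>
  have sum: "(\<Sum>j<n. 1 / (1 + d j) / real n * a j) \<le> real n * d i"
  proof -
    have "avg (\<lambda>j. of_real (1 / (1 + d j))) = S0 + of_real x0 \<cdot>\<^sub>m 1\<^sub>m N"
      unfolding S0_eq by (intro eq_matI) (auto simp: avg_def wsum_def)
    then have "T0 * (avg (\<lambda>j. of_real (1 / (1 + d j))) * T0) = T0 + of_real x0 \<cdot>\<^sub>m (T0 * (1\<^sub>m N * T0))"
      using T0_carrier S0_carrier
      by (simp add: add_mult_distrib_mat[of _ N N _ _ N] mult_add_distrib_mat[of _ N N _ N]
        mult_smult_assoc_mat[of _ N N _ N] mult_smult_distrib[of _ N N _ N] S0_T0)
    then have "\<Omega> i * (T0 * (avg (\<lambda>j. of_real (1 / (1 + d j))) * T0))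
        = \<Omega> i * T0 + of_real x0 \<cdot>\<^sub>m (\<Omega> i * (T0 * (1\<^sub>m N * T0)))"
      using C by (simp add: mult_add_distrib_mat[of _ N N _ N] mult_smult_distrib[of _ N N _ N])
    then have "mat_trace (\<Omega> i * (T0 * (avg (\<lambda>j. of_real (1 / (1 + d j))) * T0)))
        = of_real (real n * d i) + of_real x0 * mat_trace (\<Omega> i * (T0 * (1\<^sub>m N * T0)))"
      using C trace_\<Omega>_T0[OF i] by (simp add: mat_trace_add[of _ N] mat_trace_smult[of _ N])
    then have "(\<Sum>j<n. of_real (1 / (1 + d j)) / of_nat n * of_real (a j))
        = of_real (real n * d i) + of_real x0 * mat_trace (\<Omega> i * (T0 * (1\<^sub>m N * T0)))"
      by (simp only: exp)
    moreover have "(\<Sum>j<n. of_real (1 / (1 + d j)) / of_nat n * complex_of_real (a j))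
        = of_real (\<Sum>j<n. 1 / (1 + d j) / real n * a j)"
      by simp
    ultimately have "complex_of_real (\<Sum>j<n. 1 / (1 + d j) / real n * a j)
        = of_real (real n * d i) + of_real x0 * mat_trace (\<Omega> i * (T0 * (1\<^sub>m N * T0)))"
      by (simp only:)
    from arg_cong[OF this, of Re]
    have "(\<Sum>j<n. 1 / (1 + d j) / real n * a j) = real n * d i + x0 * Re (mat_trace (\<Omega> i * (T0 * (1\<^sub>m N * T0))))"
      by (simp only: plus_complex.sel Re_complex_of_real Re_of_real_times)
    moreover have "0 \<le> Re (mat_trace (\<Omega> i * (T0 * (1\<^sub>m N * T0))))"
      using psd_trace_mult[OF \<Omega>_psd[OF i] psd_congruence[OF T0_selfadj psd_one]]
      by (simp add: complex_nonneg_Reals_iff)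
    ultimately show ?thesis using x0_neg by (simp add: mult_nonpos_nonneg)
  qed
  have "cmod (mat_trace (\<Omega> i * (T0 * (avg (\<lambda>j. f j / of_real (1 + d j)) * T0))))
      \<le> (\<Sum>j<n. cmod (f j / of_real (1 + d j) / of_nat n * of_real (a j)))"
    unfolding exp by (rule norm_sum)
  also have "\<dots> \<le> (\<Sum>j<n. E * (1 / (1 + d j) / real n * a j))"
  proof (rule sum_mono)
    fix j assume "j \<in> {..<n}"
    then have j: "j < n" by simp
    have "cmod (f j / of_real (1 + d j) / of_nat n * of_real (a j)) = cmod (f j) * (1 / (1 + d j) / real n * a j)"
      using d_nonneg[OF j] a(2)[OF j] by (simp add: norm_mult norm_divide del: of_real_add)
    also have "\<dots> \<le> E * (1 / (1 + d j) / real n * a j)"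
      using d_nonneg[OF j] a(2)[OF j] f[OF j] by (intro mult_right_mono) auto
    finally show "cmod (f j / of_real (1 + d j) / of_nat n * of_real (a j)) \<le> E * (1 / (1 + d j) / real n * a j)" .
  qed
  also have "\<dots> \<le> E * (real n * d i)"
    unfolding sum_distrib_left[symmetric] by (rule mult_left_mono[OF sum E])
  finally show ?thesis using n_pos by (simp add: norm_divide divide_le_eq mult_ac)
qed

end

section \<open>Stieltjes transforms and null intervals\<close>

lemma stieltjes_integrable:
  assumes \<nu>: "finite_meas_Rplus \<nu>" and s: "0 < s" and z: "\<And>t. 0 \<le> t \<Longrightarrow> s \<le> cmod (of_real t - z)"
  shows "integrable \<nu> (\<lambda>t. 1 / (complex_of_real t - z))"
proof -
  interpret finite_measure \<nu> using \<nu> by (simp add: finite_meas_Rplus_def)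
  have [measurable_cong]: "sets \<nu> = sets borel" using \<nu> by (simp add: finite_meas_Rplus_def)
  have "AE t in \<nu>. t \<notin> {..<0}"
    using \<nu> by (intro AE_not_in) (auto simp: finite_meas_Rplus_def null_sets_def)
  then have "AE t in \<nu>. norm (1 / (complex_of_real t - z)) \<le> 1 / s"
  proof (rule eventually_mono)
    fix t :: real assume "t \<notin> {..<0}"
    then show "norm (1 / (complex_of_real t - z)) \<le> 1 / s"
      using z[of t] s by (auto simp: norm_divide intro!: divide_left_mono mult_pos_pos)
  qed
  then show ?thesis by (rule integrable_const_bound) measurable
qed

text \<open>The two kernels differ by \<open>(z - z') / ((t - z) (t - z'))\<close>. The constant
  involves the mass of \<open>\<nu>\<close> and the distance to the half-line, so it serves for
  continuity only; the uniform Lipschitz bound comes from the system.\<close>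

lemma stieltjes_Lipschitz:
  assumes \<nu>: "finite_meas_Rplus \<nu>" and s: "0 < s"
    and z: "\<And>t. 0 \<le> t \<Longrightarrow> s \<le> cmod (of_real t - z)" and z': "\<And>t. 0 \<le> t \<Longrightarrow> s \<le> cmod (of_real t - z')"
  shows "cmod (stieltjes \<nu> z - stieltjes \<nu> z') \<le> cmod (z - z') * (measure \<nu> (space \<nu>) / s\<^sup>2)"
proof -
  interpret finite_measure \<nu> using \<nu> by (simp add: finite_meas_Rplus_def)
  have "AE t in \<nu>. t \<notin> {..<0}"
    using \<nu> by (intro AE_not_in) (auto simp: finite_meas_Rplus_def null_sets_def)
  then have "AE t in \<nu>. norm (1 / (complex_of_real t - z) - 1 / (complex_of_real t - z')) \<le> cmod (z - z') / s\<^sup>2"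
  proof (rule eventually_mono)
    fix t :: real assume "t \<notin> {..<0}"
    then have t: "s \<le> cmod (of_real t - z)" "s \<le> cmod (of_real t - z')" using z z' by auto
    then have nz: "complex_of_real t - z \<noteq> 0" "complex_of_real t - z' \<noteq> 0" using s by auto
    have "1 / (complex_of_real t - z) - 1 / (complex_of_real t - z')
        = (z - z') / ((complex_of_real t - z) * (complex_of_real t - z'))"
      using nz by (simp add: divide_simps)
    moreover have "s\<^sup>2 \<le> cmod (of_real t - z) * cmod (of_real t - z')"
      unfolding power2_eq_square using t s by (intro mult_mono) auto
    ultimately show "norm (1 / (complex_of_real t - z) - 1 / (complex_of_real t - z')) \<le> cmod (z - z') / s\<^sup>2"
      using s nz by (auto simp: norm_divide norm_mult intro!: divide_left_mono mult_pos_pos)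
  qed
  then have "norm (\<integral>t. 1 / (complex_of_real t - z) - 1 / (complex_of_real t - z') \<partial>\<nu>) \<le> (\<integral>t. cmod (z - z') / s\<^sup>2 \<partial>\<nu>)"
    by (intro order.trans[OF integral_norm_bound] integral_mono_AE') auto
  then show ?thesis
    using stieltjes_integrable[OF \<nu> s z] stieltjes_integrable[OF \<nu> s z']
    by (simp add: stieltjes_def mult.commute)
qed

lemma closed_Rplus: "closed Rplus"
proof -
  have "Rplus = \<real>\<^sub>\<ge>\<^sub>0" by (auto simp: Rplus_def nonneg_Reals_def)
  then show ?thesis by simp
qed

lemma continuous_on_stieltjes:
  assumes \<nu>: "finite_meas_Rplus \<nu>"
  shows "continuous_on (- Rplus) (stieltjes \<nu>)"
proof (rule continuous_at_imp_continuous_on, intro ballI)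
  fix z0 assume "z0 \<in> - Rplus"
  \<comment> \<open>With a free ball of radius \<open>2 * s\<close>, all points within
    \<open>s\<close> of \<open>z0\<close> keep distance \<open>s\<close> from the half-line.\<close>
  then obtain s where s: "0 < s" "ball z0 (2 * s) \<subseteq> - Rplus"
    using closed_Rplus by (metis open_Compl open_contains_ball field_sum_of_halves half_gt_zero mult_2)
  have far: "s \<le> cmod (of_real t - z)" if "dist z z0 \<le> s" "0 \<le> t" for t z
  proof -
    have "complex_of_real t \<in> Rplus" using that by (auto simp: Rplus_def)
    then have "2 * s \<le> cmod (of_real t - z0)" using s(2) by (force simp: dist_norm norm_minus_commute)
    also have "\<dots> \<le> cmod (of_real t - z) + cmod (z - z0)"
      using norm_triangle_ineq[of "of_real t - z" "z - z0"] by simp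
    finally show ?thesis using that(1) by (simp add: dist_norm)
  qed
  define B where "B = measure \<nu> (space \<nu>) / s\<^sup>2"
  have lip: "dist (stieltjes \<nu> z) (stieltjes \<nu> z0) \<le> dist z z0 * B" if "dist z z0 \<le> s" for z
    using stieltjes_Lipschitz[OF \<nu> s(1), of z z0] far[OF that] far[of z0] s(1) by (simp add: B_def dist_norm)
  have "((\<lambda>z. dist z z0 * B) \<longlongrightarrow> dist z0 z0 * B) (at z0)" by (intro tendsto_intros)
  moreover have "eventually (\<lambda>z. dist (stieltjes \<nu> z) (stieltjes \<nu> z0) \<le> dist z z0 * B) (at z0)"
    using lip s(1) unfolding eventually_at by (intro exI[of _ s]) auto
  ultimately have "((\<lambda>z. dist (stieltjes \<nu> z) (stieltjes \<nu> z0)) \<longlongrightarrow> 0) (at z0)"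
    using tendsto_sandwich[of "\<lambda>_. 0" "\<lambda>z. dist (stieltjes \<nu> z) (stieltjes \<nu> z0)" "at z0"
        "\<lambda>z. dist z z0 * B" 0] by simp
  then show "isCont (stieltjes \<nu>) z0"
    unfolding isCont_def by (rule tendsto_dist_iff[THEN iffD2])
qed

section \<open>From bounds on the imaginary part to null intervals\<close>

text \<open>The imaginary part integrates the Poisson kernel \<open>y / ((t - x)^2 + y^2)\<close>,
  which is at least \<open>1 / (2 * y)\<close> on the ball.\<close>

lemma measure_ball_le_of_Im_stieltjes:
  assumes \<mu>: "finite_meas_Rplus \<mu>" and y: "0 < y" and Im: "Im (stieltjes \<mu> (Complex x y)) \<le> C * y"
  shows "measure \<mu> (ball x y) \<le> 2 * C * y\<^sup>2"
proof -
  interpret finite_measure \<mu> using \<mu> by (simp add: finite_meas_Rplus_def)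
  have sets: "sets \<mu> = sets borel" using \<mu> by (simp add: finite_meas_Rplus_def)
  have far: "y \<le> cmod (of_real t - Complex x y)" for t
    using abs_Im_le_cmod[of "of_real t - Complex x y"] y by simp
  have int: "integrable \<mu> (\<lambda>t. 1 / (complex_of_real t - Complex x y))"
    by (rule stieltjes_integrable[OF \<mu> y far])
  have eq: "Im (1 / (complex_of_real t - Complex x y)) = y / ((t - x)\<^sup>2 + y\<^sup>2)" for t
    by (simp add: Im_divide power2_eq_square)
  have "measure \<mu> (ball x y) / (2 * y) = (\<integral>t. indicator (ball x y) t * (1 / (2 * y)) \<partial>\<mu>)"
    using sets by simp
  also have "\<dots> \<le> (\<integral>t. y / ((t - x)\<^sup>2 + y\<^sup>2) \<partial>\<mu>)"
  proof (rule integral_mono)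
    show "integrable \<mu> (\<lambda>t. indicator (ball x y) t * (1 / (2 * y)))"
      using sets by (intro integrable_mult_left) (auto simp: emeasure_eq_measure)
    show "integrable \<mu> (\<lambda>t. y / ((t - x)\<^sup>2 + y\<^sup>2))"
      using integrable_Im[OF int] by (simp only: eq)
    fix t
    show "indicator (ball x y) t * (1 / (2 * y)) \<le> y / ((t - x)\<^sup>2 + y\<^sup>2)"
    proof (cases "t \<in> ball x y")
      case True
      then have "\<bar>t - x\<bar> \<le> y" by (simp add: dist_real_def abs_minus_commute)
      then have "(t - x)\<^sup>2 \<le> y\<^sup>2" by (metis abs_ge_zero power2_abs power_mono)
      then have "y / (2 * y\<^sup>2) \<le> y / ((t - x)\<^sup>2 + y\<^sup>2)"
        using y by (intro divide_left_mono mult_pos_pos add_nonneg_pos) auto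
      then show ?thesis using True y by (simp add: power2_eq_square)
    next
      case False
      then show ?thesis using y by simp
    qed
  qed
  also have "\<dots> = Im (stieltjes \<mu> (Complex x y))"
    unfolding stieltjes_def using integral_Im[OF int] by (simp only: eq)
  also have "\<dots> \<le> C * y" by (rule Im)
  finally show ?thesis using y by (simp add: field_simps power2_eq_square)
qed

text \<open>Turns a comparison of the values at \<open>x + iy\<close> and \<open>x - iy\<close> into
  a bound on the imaginary part.\<close>

lemma cnj_stieltjes: "stieltjes \<mu> (cnj z) = cnj (stieltjes \<mu> z)"
  using Bochner_Integration.integral_cnj[of \<mu> "\<lambda>t. 1 / (complex_of_real t - z)"] by (simp add: stieltjes_def)

text \<open>The interval is covered by \<open>K + 1\<close> balls of radius \<open>a / K\<close>,
  each of mass \<open>O(1/K^2)\<close>, so the total mass is \<open>O(1/K)\<close> for every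
  \<open>K\<close>.\<close>

lemma measure_interval_zero_of_quadratic:
  assumes fin: "finite_measure \<mu>" and sets: "sets \<mu> = sets borel" and a: "0 < a"
    and ball: "\<And>x y. 0 \<le> x \<Longrightarrow> x \<le> a \<Longrightarrow> 0 < y \<Longrightarrow> y \<le> a \<Longrightarrow> measure \<mu> (ball x y) \<le> C * y\<^sup>2"
  shows "emeasure \<mu> {0..a} = 0"
proof -
  interpret finite_measure \<mu> by (rule fin)
  have C: "0 \<le> C * a\<^sup>2" using ball[of 0 a] a by (intro order.trans[OF measure_nonneg]) auto
  have bound: "measure \<mu> {0..a} \<le> 2 * C * a\<^sup>2 / real K" if K: "0 < K" for K :: nat
  proof -
    have cov: "{0..a} \<subseteq> (\<Union>k\<in>{..K}. ball (real k * a / real K) (a / real K))"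
    proof
      fix t assume t: "t \<in> {0..a}"
      \<comment> \<open>Rounding down puts \<open>t\<close> in a half-open cell starting at a
        centre, hence strictly inside the open ball. The index \<open>K\<close> occurs for
        \<open>t = a\<close>, so \<open>K + 1\<close> balls are used.\<close>
      define k where "k = nat \<lfloor>t * real K / a\<rfloor>"
      have nn: "0 \<le> t * real K / a" using t a by simp
      then have k: "real k \<le> t * real K / a" "t * real K / a < real k + 1" unfolding k_def by linarith+
      have "t * real K / a \<le> real K" using t a by (simp add: divide_le_eq mult.commute mult_right_mono)
      then have "k \<le> K" using k by linarith
      moreover have "real k * a / real K \<le> t" "t < real k * a / real K + a / real K"
        using k a K by (simp_all add: field_simps)
      then have "t \<in> ball (real k * a / real K) (a / real K)" by (simp add: dist_real_def)
      ultimately show "t \<in> (\<Union>k\<in>{..K}. ball (real k * a / real K) (a / real K))" by blast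
    qed
    have "measure \<mu> {0..a} \<le> measure \<mu> (\<Union>k\<in>{..K}. ball (real k * a / real K) (a / real K))"
      using cov sets by (intro finite_measure_mono) auto
    also have "\<dots> \<le> (\<Sum>k\<le>K. measure \<mu> (ball (real k * a / real K) (a / real K)))"
    proof (rule finite_measure_subadditive_finite)
      have "ball u v \<in> sets \<mu>" for u v :: real by (simp add: sets)
      then show "(\<lambda>k. ball (real k * a / real K) (a / real K)) ` {..K} \<subseteq> sets \<mu>" by blast
    qed simp
    also have "\<dots> \<le> (\<Sum>k\<le>K. C * (a / real K)\<^sup>2)"
    proof (rule sum_mono)
      fix k assume "k \<in> {..K}"
      then have "real k \<le> real K" "1 \<le> real K" using K by auto
      then show "measure \<mu> (ball (real k * a / real K) (a / real K)) \<le> C * (a / real K)\<^sup>2"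
        using a K by (intro ball) (auto simp: divide_le_eq mult.commute mult_left_mono)
    qed
    also have "\<dots> = (C * a\<^sup>2) * ((real K + 1) / (real K)\<^sup>2)"
      by (simp add: power_divide algebra_simps)
    also have "\<dots> \<le> (C * a\<^sup>2) * (2 / real K)"
    proof (rule mult_left_mono[OF _ C])
      have "1 \<le> real K" using K by simp
      then have "(real K + 1) * real K \<le> 2 * (real K)\<^sup>2"
        by (simp add: power2_eq_square algebra_simps)
      then show "(real K + 1) / (real K)\<^sup>2 \<le> 2 / real K"
        using K by (simp add: frac_le_eq divide_simps power2_eq_square mult_ac)
    qed
    finally show ?thesis by (simp add: mult_ac)
  qed
  have "(\<lambda>K. 2 * C * a\<^sup>2 / real K) \<longlonglongrightarrow> 0"
    by (rule lim_const_over_n)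
  then have "measure \<mu> {0..a} \<le> 0"
    using bound by (intro tendsto_lowerbound[OF _ _ trivial_limit_sequentially, of "\<lambda>K. 2 * C * a\<^sup>2 / real K"])
      (auto intro!: eventually_sequentiallyI[of 1])
  then have "measure \<mu> {0..a} = 0" using measure_nonneg[of \<mu> "{0..a}"] by linarith
  then show ?thesis by (simp add: emeasure_eq_measure)
qed

text \<open>Halving the interval leaves room, around each of its points, for a ball of radius
  \<open>a / 2\<close> inside the two null sets.\<close>

lemma support_disjoint:
  assumes sets: "sets \<mu> = sets borel" and neg: "emeasure \<mu> {..<0} = 0" and zero: "emeasure \<mu> {0..a} = 0"
    and a: "0 < a"
  shows "{0..a / 2} \<inter> meas_support \<mu> = {}"
proof -
  have "x \<notin> meas_support \<mu>" if x: "x \<in> {0..a / 2}" for x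
  proof -
    have "ball x (a / 2) \<subseteq> {..<0} \<union> {0..a}" using x by (auto simp: dist_real_def)
    then have "emeasure \<mu> (ball x (a / 2)) \<le> emeasure \<mu> ({..<0} \<union> {0..a})"
      using sets by (intro emeasure_mono) auto
    also have "\<dots> \<le> emeasure \<mu> {..<0} + emeasure \<mu> {0..a}"
      using sets by (intro emeasure_subadditive) auto
    finally have "\<not> 0 < emeasure \<mu> (ball x (a / 2))" using neg zero by simp
    then show ?thesis using a unfolding meas_support_def by (auto intro!: exI[of _ "a / 2"])
  qed
  then show ?thesis by blast
qed

section \<open>Lipschitz continuity near the origin\<close>

context det_equiv_base
begin

text \<open>The deviation of \<open>\<delta>\<close> from its base value, in the weight
  \<open>1 + d j\<close> in which the linearised system contracts; \<open>1 + \<delta>\<close>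
  factors as \<open>(1 + d) (1 + e)\<close>.\<close>

definition e :: "nat \<Rightarrow> complex \<Rightarrow> complex" where
  "e j z = (\<delta> j z - of_real (d j)) / of_real (1 + d j)"

text \<open>The contraction factor at the base point, taken from \<open>d_ratio_le\<close>.\<close>

definition \<rho> :: real where "\<rho> = W * \<tau> / (1 + W * \<tau>)"

lemma one_plus_d_ge: "j < n \<Longrightarrow> 1 \<le> 1 + d j"
  using d_nonneg[of j] by simp

lemma one_plus_\<delta>: "j < n \<Longrightarrow> 1 + \<delta> j z = of_real (1 + d j) * (1 + e j z)"
proof -
  assume "j < n"
  then have "complex_of_real (1 + d j) \<noteq> 0" using one_plus_d_ge[of j] by (metis of_real_eq_0_iff not_one_le_zero)
  then show ?thesis by (simp add: e_def distrib_left)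
qed

lemma e_x0: "j < n \<Longrightarrow> e j (of_real x0) = 0"
  by (simp add: e_def \<delta>_x0)

lemma one_plus_e_bound: "cmod (e j z) \<le> \<theta> \<Longrightarrow> 1 - \<theta> \<le> cmod (1 + e j z)"
  using norm_triangle_ineq2[of 1 "- e j z"] by simp

text \<open>Separate radii for the two points, since one of them may be \<open>x0\<close>, where the
  radius is 0.\<close>

lemma coeff_diff:
  assumes j: "j < n" and \<theta>: "\<theta> < 1" "\<theta>' < 1" and b: "cmod (e j z) \<le> \<theta>" "cmod (e j z') \<le> \<theta>'"
  defines "f \<equiv> (e j z - e j z') / ((1 + e j z) * (1 + e j z'))"
  shows "1 / (1 + \<delta> j z') - 1 / (1 + \<delta> j z) = f / of_real (1 + d j)"
    and "cmod f \<le> cmod (e j z - e j z') / ((1 - \<theta>) * (1 - \<theta>'))"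
proof -
  have lo: "1 - \<theta> \<le> cmod (1 + e j z)" "1 - \<theta>' \<le> cmod (1 + e j z')"
    using b by (auto intro: one_plus_e_bound)
  then have nz: "1 + e j z \<noteq> 0" "1 + e j z' \<noteq> 0" using \<theta> by auto
  have "complex_of_real (1 + d j) \<noteq> 0" using one_plus_d_ge[OF j] by (metis of_real_eq_0_iff not_one_le_zero)
  then show "1 / (1 + \<delta> j z') - 1 / (1 + \<delta> j z) = f / of_real (1 + d j)"
    unfolding one_plus_\<delta>[OF j] f_def using nz by (simp add: divide_simps)
  have "(1 - \<theta>) * (1 - \<theta>') \<le> cmod (1 + e j z) * cmod (1 + e j z')"
    using lo \<theta> by (intro mult_mono) auto
  then show "cmod f \<le> cmod (e j z - e j z') / ((1 - \<theta>) * (1 - \<theta>'))"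
    unfolding f_def norm_divide norm_mult using \<theta> nz by (intro divide_left_mono mult_pos_pos) auto
qed

text \<open>A slit disc together with an a priori bound on \<open>e\<close>;
  \<open>near_slit_disc\<close> shows later that the a priori bound is automatic.\<close>

definition near :: "real \<Rightarrow> real \<Rightarrow> complex \<Rightarrow> bool" where
  "near \<theta> r z \<longleftrightarrow> z \<notin> Rplus \<and> cmod (z - of_real x0) \<le> r \<and> (\<forall>j<n. cmod (e j z) \<le> \<theta>)"

text \<open>In this region \<open>S z\<close> differs from \<open>S0\<close> by at most
  \<open>2 * \<theta> * W + r\<close>: the coefficients move by at most
  \<open>\<theta> / (1 - \<theta>) \<le> 2 * \<theta>\<close>, the shift by at most
  \<open>r\<close>. Then \<open>mat_inverse_perturbation\<close> applies.\<close>

lemma near_T: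
  assumes z: "near \<theta> r z" and \<theta>: "0 \<le> \<theta>" "\<theta> \<le> 1 / 2"
    and small: "\<tau> * (2 * \<theta> * W + r) \<le> 1 / 2"
  shows "det (S z) \<noteq> 0" "opnorm_le N (2 * \<tau>) (T z)" "opnorm_le N (2 * \<tau>\<^sup>2 * (2 * \<theta> * W + r)) (T z - T0)"
proof -
  have coeff: "cmod (1 / (1 + \<delta> j (of_real x0)) - 1 / (1 + \<delta> j z)) \<le> 2 * \<theta>" if j: "j < n" for j
  proof -
    have b: "cmod (e j z) \<le> \<theta>" "cmod (e j (of_real x0)) \<le> 0" using z j by (auto simp: near_def e_x0)
    have "\<theta> < 1" "(0::real) < 1" using \<theta> by auto
    note cd = coeff_diff[OF j this b]
    have "cmod (1 / (1 + \<delta> j (of_real x0)) - 1 / (1 + \<delta> j z))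
        \<le> cmod ((e j z - e j (of_real x0)) / ((1 + e j z) * (1 + e j (of_real x0)))) / (1 + d j)"
      using d_nonneg[OF j] by (simp only: cd(1) norm_divide norm_of_real)
    also have "\<dots> \<le> cmod ((e j z - e j (of_real x0)) / ((1 + e j z) * (1 + e j (of_real x0)))) / 1"
      using one_plus_d_ge[OF j] by (intro divide_left_mono) auto
    also have "\<dots> \<le> cmod (e j z - e j (of_real x0)) / (1 - \<theta>)"
      using cd(2) by simp
    also have "\<dots> \<le> \<theta> / (1 / 2)"
      using b \<theta> by (intro frac_le) (auto simp: e_x0[OF j])
    finally show ?thesis by simp
  qed
  have "opnorm_le N (2 * \<theta> * W + cmod (z - of_real x0) * 1) (S0 - S z)"
    unfolding S0_def S_diff by (intro opnorm_le_add opnorm_le_avg coeff opnorm_le_smult opnorm_le_one)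
  then have M: "opnorm_le N (2 * \<theta> * W + r) (S0 - S z)"
    using z by (rule_tac opnorm_le_mono) (auto simp: near_def)
  show "det (S z) \<noteq> 0" "opnorm_le N (2 * \<tau>) (T z)" "opnorm_le N (2 * \<tau>\<^sup>2 * (2 * \<theta> * W + r)) (T z - T0)"
    unfolding T_eq by (rule mat_inverse_perturbation[OF S0_carrier opnorm_le_T0 T0_S0 S_carrier M small N_pos])+
qed

text \<open>The first bound is the resolvent identity with both resolvents at most
  \<open>2 * \<tau>\<close>. The second replaces them by \<open>T0\<close>: the three terms come
  from \<open>linearised_bound\<close>, from the shift \<open>z - z'\<close>, and from the
  replacement error.\<close>

lemma T_difference:
  assumes z: "near \<theta> r z" and z': "near \<theta> r z'" and \<theta>: "0 \<le> \<theta>" "\<theta> \<le> 1 / 2"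
    and small: "\<tau> * (2 * \<theta> * W + r) \<le> 1 / 2"
    and E: "\<And>j. j < n \<Longrightarrow> cmod (e j z - e j z') \<le> E"
  shows "opnorm_le N (4 * \<tau>\<^sup>2 * (4 * E * W + cmod (z - z'))) (T z - T z')"
    and "\<And>i. i < n \<Longrightarrow> cmod (\<delta> i z - \<delta> i z') \<le> E / (1 - \<theta>)\<^sup>2 * d i + W * \<tau>\<^sup>2 * cmod (z - z')
        + 6 * W * \<tau>^3 * (2 * \<theta> * W + r) * (4 * E * W + cmod (z - z'))"
proof -
  define h where "h = cmod (z - z')"
  define \<kappa> where "\<kappa> = 2 * \<theta> * W + r"
  define Y where "Y = S z' - S z"
  define f where "f j = (e j z - e j z') / ((1 + e j z) * (1 + e j z'))" for j
  note Tz = near_T[OF z \<theta> small] and Tz' = near_T[OF z' \<theta> small]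
  have Yc: "Y \<in> carrier_mat N N" unfolding Y_def by (intro minus_carrier_mat) simp
  have c: "T z \<in> carrier_mat N N" "T z' \<in> carrier_mat N N" using Tz(2) Tz'(2) opnorm_le_carrier by blast+
  have res: "T z - T z' = T z * ((S z' - S z) * T z')"
    using det_nonzero_inverse[OF S_carrier Tz(1)] det_nonzero_inverse[OF S_carrier Tz'(1)]
    unfolding T_eq by (intro resolvent_identity) auto
  have \<theta>1: "\<theta> < 1" using \<theta> by simp
  have "0 \<le> cmod (e 0 z - e 0 z')" by simp
  then have E0: "0 \<le> E" using E[OF n_pos] by linarith
  have f: "cmod (f j) \<le> E / (1 - \<theta>)\<^sup>2" if j: "j < n" for j
  proof -
    have "cmod (f j) \<le> cmod (e j z - e j z') / ((1 - \<theta>) * (1 - \<theta>))"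
      unfolding f_def using z z' j by (intro coeff_diff[OF j \<theta>1 \<theta>1]) (auto simp: near_def)
    also have "\<dots> \<le> E / ((1 - \<theta>) * (1 - \<theta>))"
      using \<theta>1 E[OF j] by (intro divide_right_mono) auto
    finally show ?thesis by (simp add: power2_eq_square)
  qed
  have "1 / (1 + \<delta> j z') - 1 / (1 + \<delta> j z) = f j / of_real (1 + d j)" if j: "j < n" for j
    unfolding f_def using z z' j by (intro coeff_diff[OF j \<theta>1 \<theta>1]) (auto simp: near_def)
  then have avg_eq: "avg (\<lambda>j. 1 / (1 + \<delta> j z') - 1 / (1 + \<delta> j z)) = avg (\<lambda>j. f j / of_real (1 + d j))"
    unfolding avg_def by (intro wsum_cong) simp
  then have Y: "Y = avg (\<lambda>j. f j / of_real (1 + d j)) + (z - z') \<cdot>\<^sub>m 1\<^sub>m N"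
    unfolding Y_def S_diff by simp
  \<comment> \<open>The factor 4 bounds \<open>1 / (1 - \<theta>)^2\<close>; dividing by
    \<open>1 + d j \<ge> 1\<close> only helps.\<close>
  have "cmod (f j / of_real (1 + d j)) \<le> 4 * E" if j: "j < n" for j
  proof -
    have "cmod (f j / of_real (1 + d j)) \<le> cmod (f j) / 1"
      unfolding norm_divide norm_of_real using one_plus_d_ge[OF j] by (intro divide_left_mono) auto
    also have "\<dots> \<le> E / (1 - \<theta>)\<^sup>2" using f[OF j] by simp
    also have "\<dots> \<le> E / (1 / 2)\<^sup>2"
      using \<theta> E0 by (intro divide_left_mono power_mono) auto
    finally show ?thesis by (simp add: power2_eq_square)
  qed
  then have "opnorm_le N (4 * E * W + h * 1) Y"
    unfolding Y h_def by (intro opnorm_le_add opnorm_le_avg opnorm_le_smult opnorm_le_one)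
  then have oY: "opnorm_le N (4 * E * W + h) Y" by simp
  have K: "0 \<le> 4 * E * W + h" by (rule opnorm_le_nonneg[OF oY N_pos])
  have \<tau>: "0 \<le> \<tau>" "0 \<le> 2 * \<tau>" using \<tau>_pos by auto
  have \<kappa>: "0 \<le> 2 * \<tau>\<^sup>2 * \<kappa>" using opnorm_le_nonneg[OF Tz(3) N_pos] by (simp add: \<kappa>_def)
  have "opnorm_le N (2 * \<tau> * ((4 * E * W + h) * (2 * \<tau>))) (T z - T z')"
    unfolding res Y_def[symmetric] by (intro opnorm_le_mult Tz(2) Tz'(2) oY K \<tau>)
  then show "opnorm_le N (4 * \<tau>\<^sup>2 * (4 * E * W + cmod (z - z'))) (T z - T z')"
    by (simp add: h_def power2_eq_square mult_ac)
  fix i assume i: "i < n"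
  define R where "R = (T z - T0) * (Y * T z') + T0 * (Y * (T z' - T0))"
  have oR: "opnorm_le N (6 * \<tau>^3 * \<kappa> * (4 * E * W + h)) R"
  proof -
    \<comment> \<open>The two products contribute 4 and 2 to the constant 6.\<close>
    have "opnorm_le N (2 * \<tau>\<^sup>2 * \<kappa> * ((4 * E * W + h) * (2 * \<tau>)) + \<tau> * ((4 * E * W + h) * (2 * \<tau>\<^sup>2 * \<kappa>))) R"
      unfolding R_def using Tz(3) Tz'(3)
      by (intro opnorm_le_add opnorm_le_mult Tz'(2) oY K \<tau> \<kappa> opnorm_le_T0) (simp_all add: \<kappa>_def)
    then show ?thesis by (rule opnorm_le_mono) (simp add: power2_eq_square power3_eq_cube algebra_simps)
  qed
  have Rc: "R \<in> carrier_mat N N" using oR by (rule opnorm_le_carrier)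
  define X where "X = avg (\<lambda>j. f j / of_real (1 + d j))"
  have Xc: "X \<in> carrier_mat N N" by (simp add: X_def)
  have prods: "T0 * (X * T0) \<in> carrier_mat N N" "T0 * T0 \<in> carrier_mat N N" "X * T0 \<in> carrier_mat N N"
    "\<Omega> i * (T0 * (X * T0)) \<in> carrier_mat N N" "\<Omega> i * (T0 * T0) \<in> carrier_mat N N" "\<Omega> i * R \<in> carrier_mat N N"
    using Xc T0_carrier \<Omega>_carrier[OF i] Rc by (auto intro!: mult_carrier_mat[of _ N N])
  have "T z - T z' = T0 * (Y * T0) + R"
    unfolding res Y_def[symmetric] R_def by (rule triple_product_perturbation[OF c T0_carrier Yc])
  also have "T0 * (Y * T0) = T0 * (X * T0) + (z - z') \<cdot>\<^sub>m (T0 * T0)"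
    unfolding Y X_def[symmetric] using prods Xc T0_carrier
    by (simp add: add_mult_distrib_mat[of _ N N _ _ N] mult_add_distrib_mat[of _ N N _ N]
        mult_smult_assoc_mat[of _ N N _ N] mult_smult_distrib[of _ N N _ N])
  finally have dT: "T z - T z' = T0 * (X * T0) + (z - z') \<cdot>\<^sub>m (T0 * T0) + R" .
  have "\<delta> i z - \<delta> i z' = mat_trace (\<Omega> i * T z) / of_nat n - mat_trace (\<Omega> i * T z') / of_nat n"
    using \<delta>_eq[of z i] \<delta>_eq[of z' i] i z z' by (simp add: near_def)
  also have "\<dots> = mat_trace (\<Omega> i * (T z - T z')) / of_nat n"
    using c \<Omega>_carrier[OF i]
    by (simp add: mult_minus_distrib_mat[of _ N N _ N] mat_trace_diff[of _ N] diff_divide_distrib)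
  also have "\<dots> = mat_trace (\<Omega> i * (T0 * (X * T0))) / of_nat n
      + (z - z') * (mat_trace (\<Omega> i * (T0 * T0)) / of_nat n) + mat_trace (\<Omega> i * R) / of_nat n"
    unfolding dT using prods Rc \<Omega>_carrier[OF i]
    by (simp add: mult_add_distrib_mat[of _ N N _ N] mult_smult_distrib[of _ N N _ N]
        mat_trace_add[of _ N] mat_trace_smult[of _ N] add_divide_distrib)
  finally have eq: "\<delta> i z - \<delta> i z' = mat_trace (\<Omega> i * (T0 * (X * T0))) / of_nat n
      + (z - z') * (mat_trace (\<Omega> i * (T0 * T0)) / of_nat n) + mat_trace (\<Omega> i * R) / of_nat n" .
  have W: "0 \<le> W" using W_pos by simp
  have 1: "cmod (mat_trace (\<Omega> i * (T0 * (X * T0))) / of_nat n) \<le> E / (1 - \<theta>)\<^sup>2 * d i"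
    unfolding X_def by (rule linearised_bound[OF i f])
  have "cmod (mat_trace (\<Omega> i * (T0 * T0)) / of_nat n) \<le> W * (\<tau> * \<tau>)"
    by (intro trace_bound opnorm_le_mult opnorm_le_\<Omega> i opnorm_le_T0 W \<tau>)
  then have 2: "cmod ((z - z') * (mat_trace (\<Omega> i * (T0 * T0)) / of_nat n)) \<le> h * (W * (\<tau> * \<tau>))"
    unfolding norm_mult h_def by (intro mult_left_mono) auto
  have 3: "cmod (mat_trace (\<Omega> i * R) / of_nat n) \<le> W * (6 * \<tau>^3 * \<kappa> * (4 * E * W + h))"
    by (intro trace_bound opnorm_le_mult opnorm_le_\<Omega> i oR W)
  have "cmod (\<delta> i z - \<delta> i z') \<le> E / (1 - \<theta>)\<^sup>2 * d i + h * (W * (\<tau> * \<tau>)) + W * (6 * \<tau>^3 * \<kappa> * (4 * E * W + h))"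
    unfolding eq by (intro norm_triangle_le add_mono 1 2 3)
  then show "cmod (\<delta> i z - \<delta> i z') \<le> E / (1 - \<theta>)\<^sup>2 * d i + W * \<tau>\<^sup>2 * cmod (z - z')
        + 6 * W * \<tau>^3 * (2 * \<theta> * W + r) * (4 * E * W + cmod (z - z'))"
    by (simp add: h_def \<kappa>_def power2_eq_square mult_ac)
qed


end

text \<open>\<open>q\<close> is the contraction factor of the nonlinear system on the region \<open>near \<theta> r\<close>.\<close>

locale det_equiv_radius = det_equiv_base +
  fixes \<theta> r q :: real
  assumes \<theta>: "0 < \<theta>" "\<theta> \<le> 1 / 2" and r_pos: "0 < r" and q: "q < 1"
    and small: "\<tau> * (2 * \<theta> * W + r) \<le> 1 / 2"
    and contraction: "\<rho> / (1 - \<theta>)\<^sup>2 + 24 * W\<^sup>2 * \<tau>^3 * (2 * \<theta> * W + r) \<le> q"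
    and r_small: "8 * W * \<tau>\<^sup>2 * r \<le> (1 - q) * \<theta>"
begin

text \<open>Obtained by solving \<open>E \<le> q E + 4 W \<tau>^2 h\<close> for
  \<open>E\<close>.\<close>

definition L :: real where "L = 4 * W * \<tau>\<^sup>2 / (1 - q)"

lemma L_nonneg: "0 \<le> L"
  using W_pos q by (simp add: L_def)

text \<open>Applying \<open>T_difference\<close> with the largest deviation \<open>E\<close> over
  all indices bounds \<open>E\<close> by \<open>q E\<close> plus a multiple of
  \<open>cmod (z - z')\<close>; as \<open>q < 1\<close>, the \<open>E\<close> term is
  absorbed.\<close>

lemma e_Lipschitz:
  assumes z: "near \<theta> r z" and z': "near \<theta> r z'" and i: "i < n"
  shows "cmod (e i z - e i z') \<le> L * cmod (z - z')"
proof -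
  define h where "h = cmod (z - z')"
  define E where "E = Max ((\<lambda>j. cmod (e j z - e j z')) ` {..<n})"
  define \<kappa> where "\<kappa> = 2 * \<theta> * W + r"
  have \<theta>0: "0 \<le> \<theta>" using \<theta> by simp
  have E: "cmod (e j z - e j z') \<le> E" if "j < n" for j
    unfolding E_def using that by (intro Max_ge) auto
  have E0: "0 \<le> E" using E[OF i] norm_ge_zero order.trans by blast
  have \<kappa>: "0 \<le> \<kappa>" "\<tau> * \<kappa> \<le> 1 / 2" using \<theta> W_pos r_pos small by (auto simp: \<kappa>_def)
  have \<tau>: "0 < \<tau>" by (rule \<tau>_pos)
  have "cmod (e k z - e k z') \<le> q * E + 4 * W * \<tau>\<^sup>2 * h" if k: "k < n" for k
  proof -
    have dk: "1 \<le> 1 + d k" by (rule one_plus_d_ge[OF k])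
    have "e k z - e k z' = (\<delta> k z - \<delta> k z') / of_real (1 + d k)"
      by (simp add: e_def diff_divide_distrib)
    then have "cmod (e k z - e k z') = cmod (\<delta> k z - \<delta> k z') / (1 + d k)"
      using dk by (simp only: norm_divide norm_of_real)
    also have "\<dots> \<le> (E / (1 - \<theta>)\<^sup>2 * d k + W * \<tau>\<^sup>2 * h + 6 * W * \<tau>^3 * \<kappa> * (4 * E * W + h)) / (1 + d k)"
      using dk T_difference(2)[OF z z' \<theta>0 \<theta>(2) small E k] unfolding h_def \<kappa>_def
      by (intro divide_right_mono) auto
    also have "\<dots> = E / (1 - \<theta>)\<^sup>2 * (d k / (1 + d k)) + (W * \<tau>\<^sup>2 * h + 6 * W * \<tau>^3 * \<kappa> * (4 * E * W + h)) / (1 + d k)"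
      by (simp add: add_divide_distrib)
    also have "\<dots> \<le> E / (1 - \<theta>)\<^sup>2 * \<rho> + (W * \<tau>\<^sup>2 * h + 6 * W * \<tau>^3 * \<kappa> * (4 * E * W + h)) / 1"
    proof (intro add_mono mult_left_mono divide_left_mono)
      show "d k / (1 + d k) \<le> \<rho>" using d_ratio_le[OF k] by (simp add: \<rho>_def)
      show "0 \<le> W * \<tau>\<^sup>2 * h + 6 * W * \<tau>^3 * \<kappa> * (4 * E * W + h)"
        using W_pos \<tau> \<kappa> E0 by (intro add_nonneg_nonneg mult_nonneg_nonneg) (auto simp: h_def)
    qed (use dk E0 in auto)
    also have "\<dots> = (\<rho> / (1 - \<theta>)\<^sup>2 + 24 * W\<^sup>2 * \<tau>^3 * \<kappa>) * E + (1 + 6 * (\<tau> * \<kappa>)) * (W * \<tau>\<^sup>2 * h)"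
      by (simp add: algebra_simps power2_eq_square power3_eq_cube)
    \<comment> \<open>The coefficient of \<open>E\<close> is the left side of
      \<open>contraction\<close>; since \<open>\<tau> * \<kappa> \<le> 1 / 2\<close>, the other
      coefficient is at most 1 + 3 = 4.\<close>
    also have "\<dots> \<le> q * E + 4 * (W * \<tau>\<^sup>2 * h)"
      using contraction \<kappa> E0 W_pos unfolding \<kappa>_def[symmetric]
      by (intro add_mono mult_right_mono) (auto simp: h_def mult.commute)
    finally show ?thesis by (simp add: mult_ac)
  qed
  then have "E \<le> q * E + 4 * W * \<tau>\<^sup>2 * h"
    unfolding E_def using n_pos by (subst Max_le_iff) (auto simp: lessThan_empty_iff)
  then have "E \<le> L * h" using q by (simp add: L_def field_simps)
  then show ?thesis using E[OF i] by (simp add: h_def)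
qed

text \<open>The Lipschitz bound against \<open>x0\<close>, where \<open>e\<close> vanishes;
  \<open>r_small\<close> says precisely that \<open>L * r \<le> \<theta> / 2\<close>.\<close>

lemma near_half:
  assumes "near \<theta> r z" "i < n"
  shows "cmod (e i z) \<le> \<theta> / 2"
proof -
  have "near \<theta> r (of_real x0)"
    using \<theta> r_pos not_Rplus_neg[OF x0_neg] by (simp add: near_def e_x0)
  from e_Lipschitz[OF assms(1) this assms(2)]
  have "cmod (e i z) \<le> L * cmod (z - of_real x0)" by (simp add: e_x0[OF assms(2)])
  also have "\<dots> \<le> L * r" using assms L_nonneg by (intro mult_left_mono) (auto simp: near_def)
  also have "\<dots> \<le> \<theta> / 2" using r_small q by (simp add: L_def field_simps)
  finally show ?thesis .
qed

text \<open>The condition \<open>|e j| \<le> \<theta>\<close> improves itself to \<open>|e j| \<le> \<theta> / 2\<close>, hence is clopen along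
  the segment from \<open>x0\<close> to \<open>z\<close>.\<close>

lemma near_slit_disc:
  assumes z: "z \<notin> Rplus" and zr: "cmod (z - of_real x0) \<le> r"
  shows "near \<theta> r z"
proof -
  define p where "p t = of_real x0 + of_real t * (z - of_real x0)" for t :: real
  let ?I = "{0..1::real}"
  \<comment> \<open>The slit plane is star-shaped about \<open>x0\<close>: if the segment met the
    positive half-line at a point, its continuation to \<open>z\<close> would remain there.\<close>
  have p: "p t \<notin> Rplus" if t: "t \<in> ?I" for t
  proof
    assume "p t \<in> Rplus"
    then obtain s where s: "0 \<le> s" "p t = of_real s" by (auto simp: Rplus_def)
    have "t \<noteq> 0" using s x0_neg by (auto simp: p_def)
    then have t0: "0 < t" using t by simp
    have "z = of_real ((s - x0) / t + x0)"
      using s(2) t0 by (simp add: p_def field_simps)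
    moreover have "0 \<le> (s - x0) / t + x0"
    proof -
      have "s - x0 \<le> (s - x0) / t" using t t0 s(1) x0_neg by (simp add: le_divide_eq mult_left_le)
      then show ?thesis using s(1) by simp
    qed
    ultimately have "z \<in> Rplus" unfolding Rplus_def by (metis atLeast_iff imageI)
    then show False using z by simp
  qed
  have pr: "cmod (p t - of_real x0) \<le> r" if t: "t \<in> ?I" for t
    using zr t mult_right_mono[of t 1 "cmod (z - of_real x0)"] by (simp add: p_def norm_mult)
  have cont: "continuous_on ?I (\<lambda>t. cmod (e j (p t)))" if j: "j < n" for j
  proof -
    obtain \<nu> where \<nu>: "finite_meas_Rplus \<nu>" "\<And>z. z \<notin> Rplus \<Longrightarrow> \<delta> j z = stieltjes \<nu> z"
      using solution j by (auto simp: delta_solution_def is_stieltjes_Rplus_def)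
    have "continuous_on (- Rplus) (\<delta> j)"
      using continuous_on_stieltjes[OF \<nu>(1)] \<nu>(2) continuous_on_cong[of "- Rplus" "- Rplus" "\<delta> j" "stieltjes \<nu>"]
      by simp
    moreover have "continuous_on ?I p" unfolding p_def by (intro continuous_intros)
    ultimately have "continuous_on ?I (\<lambda>t. \<delta> j (p t))"
      using p by (intro continuous_on_compose2[of "- Rplus" "\<delta> j" ?I p]) auto
    moreover have "complex_of_real (1 + d j) \<noteq> 0"
      using one_plus_d_ge[OF j] by (metis of_real_eq_0_iff not_one_le_zero)
    ultimately show ?thesis unfolding e_def by (intro continuous_intros ballI)
  qed
  define G where "G = {t \<in> ?I. \<forall>j<n. cmod (e j (p t)) \<le> \<theta>}"
  have half: "cmod (e j (p t)) \<le> \<theta> / 2" if "t \<in> G" "j < n" for t j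
    using that p pr by (intro near_half) (auto simp: G_def near_def)
  have ne: "{..<n} \<noteq> {}" using n_pos by (auto simp: lessThan_empty_iff)
  have "G = (\<Inter>j\<in>{..<n}. ?I \<inter> (\<lambda>t. cmod (e j (p t))) -` {..\<theta>})"
    using ne by (auto simp: G_def)
  also have "closedin (top_of_set ?I) \<dots>"
    using cont ne by (intro closedin_INT continuous_closedin_preimage) auto
  finally have cl: "closedin (top_of_set ?I) G" .
  have "cmod (e j (p t)) < \<theta>" if "t \<in> G" "j < n" for t j
    using half[OF that] \<theta> by simp
  \<comment> \<open>Described with \<open>\<le>\<close> the set is relatively closed, with
    \<open><\<close> relatively open; the self-improvement makes the two descriptions agree.\<close>
  then have "G = {t \<in> ?I. \<forall>j<n. cmod (e j (p t)) < \<theta>}"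
    unfolding G_def by (auto intro: less_imp_le)
  also have "\<dots> = (\<Inter>j\<in>{..<n}. ?I \<inter> (\<lambda>t. cmod (e j (p t))) -` {..<\<theta>})"
    using ne by auto
  also have "openin (top_of_set ?I) \<dots>"
    using cont ne by (intro openin_INT2 continuous_openin_preimage_gen) auto
  finally have op: "openin (top_of_set ?I) G" .
  have "0 \<in> G" using \<theta> by (simp add: G_def p_def e_x0)
  moreover have "connected ?I" by simp
  ultimately have "G = ?I" using op cl unfolding connected_clopen by blast
  then have "1 \<in> G" by simp
  then show ?thesis using z zr by (simp add: G_def near_def p_def)
qed

text \<open>\<open>e_Lipschitz\<close> compares any two points of the slit disc directly and not
  along a path, so it also holds for points on opposite sides of the slit.\<close>

lemma m_fun_conj_diff_le:
  assumes y: "0 < y" and r1: "cmod (Complex x y - of_real x0) \<le> r" "cmod (Complex x (- y) - of_real x0) \<le> r"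
  shows "cmod (m_fun N n \<Omega> \<delta> (Complex x y) - m_fun N n \<Omega> \<delta> (Complex x (- y)))
    \<le> 8 * \<tau>\<^sup>2 * (4 * L * W + 1) * y"
proof -
  let ?z = "Complex x y" and ?z' = "Complex x (- y)"
  have nr: "?z \<notin> Rplus" "?z' \<notin> Rplus" using y by (auto simp: Rplus_def complex_eq_iff)
  have z: "near \<theta> r ?z" and z': "near \<theta> r ?z'" using near_slit_disc nr r1 by auto
  have h: "cmod (?z - ?z') = 2 * y"
  proof -
    have "?z - ?z' = \<i> * of_real (2 * y)" by (simp add: complex_eq_iff)
    then show ?thesis using y by (simp only: norm_mult norm_of_real) simp
  qed
  have \<theta>0: "0 \<le> \<theta>" using \<theta> by simp
  have E: "cmod (e j ?z - e j ?z') \<le> L * (2 * y)" if "j < n" for j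
    using e_Lipschitz[OF z z' that] by (simp only: h)
  have op: "opnorm_le N (4 * \<tau>\<^sup>2 * (4 * (L * (2 * y)) * W + 2 * y)) (T ?z - T ?z')"
    using T_difference(1)[OF z z' \<theta>0 \<theta>(2) small E] by (simp only: h)
  have c: "T ?z \<in> carrier_mat N N" "T ?z' \<in> carrier_mat N N"
    using near_T(2)[OF z \<theta>0 \<theta>(2) small] near_T(2)[OF z' \<theta>0 \<theta>(2) small] opnorm_le_carrier by blast+
  have "m_fun N n \<Omega> \<delta> ?z - m_fun N n \<Omega> \<delta> ?z' = mat_trace (T ?z - T ?z') / of_nat N"
    using c by (simp add: m_fun_def mat_trace_diff[of _ N] diff_divide_distrib)
  also have "cmod \<dots> \<le> 4 * \<tau>\<^sup>2 * (4 * (L * (2 * y)) * W + 2 * y)"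
    using cmod_mat_trace_le[OF op] N_pos by (simp add: norm_divide divide_le_eq mult.commute)
  finally show ?thesis by (simp add: algebra_simps)
qed

end

section \<open>Choice of the constants and the uniform gap\<close>

text \<open>With \<open>q\<close> midway between \<open>\<rho>\<close> and 1 and
  \<open>r = k * \<theta>\<close>, the last condition holds for every positive
  \<open>\<theta>\<close>, while the two remaining estimates hold in the limit
  \<open>\<theta> \<rightarrow> 0\<close>.\<close>

lemma radius_exists:
  fixes W \<tau> \<rho> :: real
  assumes W: "0 < W" and \<tau>: "0 < \<tau>" and \<rho>: "\<rho> < 1"
  shows "\<exists>\<theta> r q. 0 < \<theta> \<and> \<theta> \<le> 1 / 2 \<and> 0 < r \<and> q < 1 \<and> \<tau> * (2 * \<theta> * W + r) \<le> 1 / 2 \<and>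
    \<rho> / (1 - \<theta>)\<^sup>2 + 24 * W\<^sup>2 * \<tau>^3 * (2 * \<theta> * W + r) \<le> q \<and> 8 * W * \<tau>\<^sup>2 * r \<le> (1 - q) * \<theta>"
proof -
  define q where "q = (1 + \<rho>) / 2"
  have q: "q < 1" "\<rho> < q" using \<rho> by (auto simp: q_def)
  define k where "k = min 1 ((1 - q) / (8 * W * \<tau>\<^sup>2))"
  have k: "0 < k" "8 * W * \<tau>\<^sup>2 * k \<le> 1 - q"
  proof -
    have "0 < 8 * W * \<tau>\<^sup>2" using W \<tau> by simp
    then have pos: "0 < 8 * W * \<tau>\<^sup>2" .
    then show "0 < k" using q by (simp add: k_def)
    have "8 * W * \<tau>\<^sup>2 * k \<le> 8 * W * \<tau>\<^sup>2 * ((1 - q) / (8 * W * \<tau>\<^sup>2))"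
      using pos by (intro mult_left_mono) (auto simp: k_def)
    also have "\<dots> = 1 - q" using less_imp_neq[OF pos] by (metis nonzero_mult_div_cancel_left times_divide_eq_right)
    finally show "8 * W * \<tau>\<^sup>2 * k \<le> 1 - q" .
  qed
  have "((\<lambda>\<theta>. \<rho> / (1 - \<theta>)\<^sup>2 + 24 * W\<^sup>2 * \<tau>^3 * (2 * \<theta> * W + k * \<theta>)) \<longlongrightarrow> \<rho> / (1 - 0)\<^sup>2 + 24 * W\<^sup>2 * \<tau>^3 * (2 * 0 * W + k * 0)) (at_right 0)"
    by (intro tendsto_intros) auto
  then have "eventually (\<lambda>\<theta>. \<rho> / (1 - \<theta>)\<^sup>2 + 24 * W\<^sup>2 * \<tau>^3 * (2 * \<theta> * W + k * \<theta>) < q) (at_right 0)"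
    by (rule order_tendstoD) (use q in auto)
  moreover have "((\<lambda>\<theta>. \<tau> * (2 * \<theta> * W + k * \<theta>)) \<longlongrightarrow> \<tau> * (2 * 0 * W + k * 0)) (at_right 0)"
    by (intro tendsto_intros)
  then have "eventually (\<lambda>\<theta>. \<tau> * (2 * \<theta> * W + k * \<theta>) < 1 / 2) (at_right 0)"
    by (rule order_tendstoD) auto
  moreover have "eventually (\<lambda>\<theta>::real. \<theta> \<in> {0<..<1 / 2}) (at_right 0)"
    by (rule eventually_at_right_real) auto
  ultimately have "eventually (\<lambda>\<theta>. \<rho> / (1 - \<theta>)\<^sup>2 + 24 * W\<^sup>2 * \<tau>^3 * (2 * \<theta> * W + k * \<theta>) < q \<and>
      \<tau> * (2 * \<theta> * W + k * \<theta>) < 1 / 2 \<and> \<theta> \<in> {0<..<1 / 2}) (at_right 0)"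
    by eventually_elim auto
  then obtain \<theta> where \<theta>: "\<rho> / (1 - \<theta>)\<^sup>2 + 24 * W\<^sup>2 * \<tau>^3 * (2 * \<theta> * W + k * \<theta>) < q"
      "\<tau> * (2 * \<theta> * W + k * \<theta>) < 1 / 2" "\<theta> \<in> {0<..<1 / 2}"
    using eventually_happens[of _ "at_right (0::real)"] by auto
  have "8 * W * \<tau>\<^sup>2 * (k * \<theta>) \<le> (1 - q) * \<theta>"
    using mult_right_mono[OF k(2), of \<theta>] \<theta>(3) by (simp add: mult_ac)
  then show ?thesis using \<theta> k q
    by (intro exI[of _ \<theta>] exI[of _ "k * \<theta>"] exI[of _ q]) auto
qed

text \<open>\<open>\<theta>\<close>, \<open>r\<close> and \<open>q\<close> are chosen from
  \<open>w\<close>, \<open>W\<close> and \<open>\<beta>\<close> before any matrix is fixed, so one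
  \<open>\<epsilon>\<close> serves all systems.\<close>

lemma uniform_gap:
  fixes w W \<beta> :: real
  assumes w: "0 < w" and W: "0 < W" and \<beta>: "0 < \<beta>"
  shows "\<exists>\<epsilon>>0. \<forall>N n \<Omega> \<delta> \<mu>. det_equiv N n \<Omega> \<delta> w W \<beta> \<longrightarrow> finite_meas_Rplus \<mu> \<longrightarrow>
    (\<forall>z. z \<notin> Rplus \<longrightarrow> m_fun N n \<Omega> \<delta> z = stieltjes \<mu> z) \<longrightarrow> {0..\<epsilon>} \<inter> meas_support \<mu> = {}"
proof -
  define t0 where "t0 = 1 / (w * \<beta>)"
  have t0: "0 < t0" using w \<beta> by (simp add: t0_def)
  define r0 where "r0 = W * t0 / (1 + W * t0)"
  have "r0 < 1" using W t0 by (simp add: r0_def add_pos_pos)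
  from radius_exists[OF W t0 this] obtain \<theta> r q where
    c: "0 < \<theta>" "\<theta> \<le> 1 / 2" "0 < r" "q < 1" "t0 * (2 * \<theta> * W + r) \<le> 1 / 2"
      "r0 / (1 - \<theta>)\<^sup>2 + 24 * W\<^sup>2 * t0^3 * (2 * \<theta> * W + r) \<le> q" "8 * W * t0\<^sup>2 * r \<le> (1 - q) * \<theta>"
    by blast
  \<comment> \<open>The null interval will be \<open>{0..r / 4}\<close>; half of it is given up in
    \<open>support_disjoint\<close>.\<close>
  have "{0..r / 8} \<inter> meas_support \<mu> = {}"
    if D: "det_equiv N n \<Omega> \<delta> w W \<beta>" and \<mu>: "finite_meas_Rplus \<mu>"
      and m: "\<And>z. z \<notin> Rplus \<Longrightarrow> m_fun N n \<Omega> \<delta> z = stieltjes \<mu> z" for N n \<Omega> \<delta> \<mu>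
  proof -
    interpret det_equiv N n \<Omega> \<delta> w W \<beta> by (rule D)
    \<comment> \<open>For \<open>x\<close> and \<open>y\<close> up to \<open>r / 4\<close> the
      distance from \<open>x + iy\<close> to \<open>- (r / 2)\<close> is at most
      \<open>3 * r / 4 + r / 4 = r\<close>.\<close>
    interpret det_equiv_base N n \<Omega> \<delta> w W \<beta> "- (r / 2)"
      by unfold_locales (use c in simp)
    have t: "det_equiv.\<tau> w \<beta> = t0" by (simp add: det_equiv.\<tau>_def[OF D] t0_def)
    interpret det_equiv_radius N n \<Omega> \<delta> w W \<beta> "- (r / 2)" \<theta> r q
      by unfold_locales (use c in \<open>simp_all add: t det_equiv_base.\<rho>_def[OF det_equiv_base_axioms] r0_def\<close>)
    \<comment> \<open>Half the constant of \<open>m_fun_conj_diff_le\<close>, because conjugate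
      values differ by twice the imaginary part.\<close>
    define C where "C = 4 * t0\<^sup>2 * (4 * L * W + 1)"
    have ball: "measure \<mu> (ball x y) \<le> 2 * C * y\<^sup>2"
      if xy: "0 \<le> x" "x \<le> r / 4" "0 < y" "y \<le> r / 4" for x y
    proof (rule measure_ball_le_of_Im_stieltjes[OF \<mu> xy(3)])
      have close: "cmod (Complex x y' - of_real (- (r / 2))) \<le> r" if "\<bar>y'\<bar> = y" for y'
      proof -
        have "cmod (Complex x y' - of_real (- (r / 2))) \<le> \<bar>x + r / 2\<bar> + \<bar>y'\<bar>"
          using cmod_le[of "Complex x y' - of_real (- (r / 2))"] by simp
        also have "\<dots> \<le> r" using xy that by simp
        finally show ?thesis .
      qed
      have nr: "Complex x y \<notin> Rplus" "Complex x (- y) \<notin> Rplus"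
        using xy by (auto simp: Rplus_def complex_eq_iff)
      have cn: "Complex x (- y) = cnj (Complex x y)" by (simp add: complex_eq_iff)
      have "cmod (stieltjes \<mu> (Complex x y) - cnj (stieltjes \<mu> (Complex x y))) \<le> 2 * C * y"
        using m_fun_conj_diff_le[OF xy(3) close close] xy unfolding m[OF nr(1)] m[OF nr(2)]
        unfolding cn cnj_stieltjes t C_def by simp
      then have "cmod (\<i> * of_real (2 * Im (stieltjes \<mu> (Complex x y)))) \<le> 2 * C * y"
        by (simp only: complex_diff_cnj mult.commute)
      then have "\<bar>2 * Im (stieltjes \<mu> (Complex x y))\<bar> \<le> 2 * C * y"
        by (simp only: norm_mult norm_of_real norm_ii)
      then show "Im (stieltjes \<mu> (Complex x y)) \<le> C * y" by simp
    qed
    have s: "sets \<mu> = sets borel" "finite_measure \<mu>" "emeasure \<mu> {..<0} = 0"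
      using \<mu> by (auto simp: finite_meas_Rplus_def)
    have r4: "0 < r / 4" using c by simp
    have "emeasure \<mu> {0..r / 4} = 0"
      by (rule measure_interval_zero_of_quadratic[OF s(2,1) r4 ball])
    from support_disjoint[OF s(1,3) this r4] show ?thesis by simp
  qed
  moreover have "0 < r / 8" using c by simp
  ultimately show ?thesis by (intro exI[of _ "r / 8"]) blast
qed

text \<open>The limsup condition keeps \<open>N k / n k\<close> below a constant less than 1 only
  for large \<open>k\<close>. The conclusion is therefore eventual, with a single
  \<open>\<epsilon>\<close> from \<open>uniform_gap\<close>.\<close>

theorem theorem1:
  fixes N n :: "nat \<Rightarrow> nat"
    and \<Omega> :: "nat \<Rightarrow> nat \<Rightarrow> complex mat"
    and \<delta> :: "nat \<Rightarrow> nat \<Rightarrow> complex \<Rightarrow> complex"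
    and \<mu> :: "nat \<Rightarrow> real measure"
  assumes N_pos: "\<And>k. 0 < N k"
    and N_le_n: "\<And>k. N k \<le> n k"
    and N_lim: "filterlim N at_top sequentially"
    and c_liminf: "0 < liminf (\<lambda>k. ereal (real (N k) / real (n k)))"
    and c_limsup: "limsup (\<lambda>k. ereal (real (N k) / real (n k))) < 1"
    and hpd: "\<And>k i. i < n k \<Longrightarrow> hpd_mat (N k) (\<Omega> k i)"
    and w_min: "\<exists>w>0. \<forall>k i l. i < n k \<longrightarrow> eigenvalue (\<Omega> k i) l \<longrightarrow> w \<le> Re l"
    and w_max: "\<exists>W. \<forall>k i l. i < n k \<longrightarrow> eigenvalue (\<Omega> k i) l \<longrightarrow> Re l \<le> W"
    and delta: "\<And>k. delta_solution (N k) (n k) (\<Omega> k) (\<delta> k)"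
    and mu_prob: "\<And>k. prob_space (\<mu> k)"
    and mu_borel: "\<And>k. sets (\<mu> k) = sets borel"
    and mu_Rplus: "\<And>k. emeasure (\<mu> k) {..<0} = 0"
    and mu_stieltjes: "\<And>k z. z \<notin> Rplus \<Longrightarrow>
                          m_fun (N k) (n k) (\<Omega> k) (\<delta> k) z = stieltjes (\<mu> k) z"
  shows "(\<forall>\<^sub>F k in sequentially. 0 \<notin> meas_support (\<mu> k)) \<and>
         (\<exists>\<epsilon>>0. \<forall>\<^sub>F k in sequentially. {0..\<epsilon>} \<inter> meas_support (\<mu> k) = {})"
proof -
  obtain w where w: "0 < w" "\<And>k i l. i < n k \<Longrightarrow> eigenvalue (\<Omega> k i) l \<Longrightarrow> w \<le> Re l"
    using w_min by blast
  obtain W0 where W0: "\<And>k i l. i < n k \<Longrightarrow> eigenvalue (\<Omega> k i) l \<Longrightarrow> Re l \<le> W0"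
    using w_max by blast
  \<comment> \<open>\<open>W0\<close> is given without a sign, whereas the locale asks for a
    positive upper bound.\<close>
  define W where "W = max W0 1"
  have W: "0 < W" "\<And>k i l. i < n k \<Longrightarrow> eigenvalue (\<Omega> k i) l \<Longrightarrow> Re l \<le> W"
    using W0 by (fastforce simp: W_def)+
  \<comment> \<open>A level strictly between the limsup and 1; its distance to 1 becomes the margin
    \<open>\<beta>\<close>.\<close>
  obtain c where c: "limsup (\<lambda>k. ereal (real (N k) / real (n k))) < ereal c" "ereal c < 1"
    using ereal_dense2[OF c_limsup] by auto
  define \<beta> where "\<beta> = 1 - c"
  have \<beta>: "0 < \<beta>" using c(2) by (simp add: \<beta>_def)
  obtain \<epsilon> where \<epsilon>: "0 < \<epsilon>" "\<And>N n \<Omega> \<delta> \<mu>. det_equiv N n \<Omega> \<delta> w W \<beta> \<Longrightarrow> finite_meas_Rplus \<mu> \<Longrightarrow>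
    (\<And>z. z \<notin> Rplus \<Longrightarrow> m_fun N n \<Omega> \<delta> z = stieltjes \<mu> z) \<Longrightarrow> {0..\<epsilon>} \<inter> meas_support \<mu> = {}"
    using uniform_gap[OF w(1) W(1) \<beta>] by blast
  have "eventually (\<lambda>k. ereal (real (N k) / real (n k)) < ereal c) sequentially"
    using c(1) by (rule Limsup_lessD)
  then have ev: "eventually (\<lambda>k. {0..\<epsilon>} \<inter> meas_support (\<mu> k) = {}) sequentially"
  proof (rule eventually_mono)
    fix k assume k: "ereal (real (N k) / real (n k)) < ereal c"
    have n: "0 < n k" using N_pos[of k] N_le_n[of k] by simp
    have sa: "selfadj (N k) (\<Omega> k i)" if "i < n k" for i
      using hpd[OF that] by (auto simp: hpd_mat_def intro: hermitian_imp_selfadj)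
    show "{0..\<epsilon>} \<inter> meas_support (\<mu> k) = {}"
    proof (rule \<epsilon>(2))
      show "det_equiv (N k) (n k) (\<Omega> k) (\<delta> k) w W \<beta>"
      proof
        show "real (N k) \<le> (1 - \<beta>) * real (n k)" using k n by (simp add: \<beta>_def divide_less_eq)
      next
        fix i and v :: "complex vec" assume i: "i < n k" and v: "v \<in> carrier_vec (N k)"
        show "w * (nrm v)\<^sup>2 \<le> Re ((\<Omega> k i *\<^sub>v v) \<bullet>c v)"
          by (rule eigenvalues_bound_form_below[OF sa[OF i] N_pos w(2)[OF i] v])
        show "Re ((\<Omega> k i *\<^sub>v v) \<bullet>c v) \<le> W * (nrm v)\<^sup>2"
          by (rule eigenvalues_bound_form_above[OF sa[OF i] N_pos W(2)[OF i] v])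
      qed (use N_pos \<beta> w W sa delta in auto)
      show "finite_meas_Rplus (\<mu> k)"
        using mu_prob[of k] mu_borel mu_Rplus
        by (auto simp: finite_meas_Rplus_def intro: prob_space.finite_measure)
    qed (rule mu_stieltjes)
  qed
  have "0 \<in> {0..\<epsilon>}" using \<epsilon>(1) by simp
  then have "eventually (\<lambda>k. 0 \<notin> meas_support (\<mu> k)) sequentially"
    using eventually_mono[OF ev, of "\<lambda>k. 0 \<notin> meas_support (\<mu> k)"] by blast
  then show ?thesis using ev \<epsilon>(1) by blast
qed

end
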